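(* Let $W$ be a smooth function on $\mathbb{R}$ with compact support in $[1,2]$. Let $\lambda_1(n), \lambda_2(n)$ be the (normalized) Hecke eigenvalues of holomorphic Hecke eigencuspforms of weights $\kappa_1$, $\kappa_2$, respectively, for $\mathrm{SL}_2(\mathbb{Z})$. Then for every $\varepsilon>0$, for all real numbers $X,H$ with $1\leq H\leq X/3$, and for every sequence of complex numbers $a(n)$, $X\leq n\leq 2X$, one has $$\sum_{h}W\left(\frac{h}{H}\right)\sum_{X\leq n\leq 2X}a(n)\lambda_{1}(n+h)\lambda_{2}(n-h)\ll X^{\varepsilon}\,\frac{X}{H}\left((XH)^{1/2}+\frac{X}{H^{1/2}}\right)\|a\|_2,$$ where $h$ and $n$ run over integers.
   Context: $\|a\|_2=\big(\sum_{X\le n\le 2X}|a(n)|^2\big)^{1/2}$ is the $\ell^2$-norm of the sequence. Hecke eigenvalues are normalized in the usual analytic way: a holomorphic Hecke eigencuspform of weight $\kappa$ for $\mathrm{SL}_2(\mathbb{Z})$, scaled so that its first Fourier coefficient is $1$, has Fourier expansion $\sum_{n\ge 1}\lambda(n)n^{(\kappa-1)/2}e^{2\pi i n z}$, and $\lambda(n)$ is its $n$-th Hecke eigenvalue (so $\lambda(1)=1$ and $\sum_{n\le x}|\lambda(n)|^2\ll x$). The notation $A\ll B$ means $|A|\le K B$ for some constant $K>0$. Here $K$ may depend on $\varepsilon$, on $W$ and on the cusp forms, but not on $X$, $H$ or the sequence $a(n)$. Since $W$ is supported in $[1,2]$, only integers $h$ with $H\le h\le 2H$ contribute to the sum, and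 for these $n\pm h\ge 1$. *)

theory Defs
  imports "HOL-Complex_Analysis.Complex_Analysis"
begin

definition upper_half_plane :: "complex set" where
  "upper_half_plane = {z. Im z > 0}"

text \<open>
  The limit in the last clause is taken as the imaginary part of z tends to infinity, uniformly
  in the real part: this is vanishing at the single cusp of the modular group.
  Values of f outside the upper half plane are never used.
\<close>

definition cusp_form :: "nat \<Rightarrow> (complex \<Rightarrow> complex) \<Rightarrow> bool" where
  "cusp_form k f \<longleftrightarrow>
     f holomorphic_on upper_half_plane \<and>
     (\<forall>a b c d :: int. a * d - b * c = 1 \<longrightarrow>
        (\<forall>z\<in>upper_half_plane.
           f ((of_int a * z + of_int b) / (of_int c * z + of_int d))
             = (of_int c * z + of_int d) ^ k * f z)) \<and>
     (f \<longlongrightarrow> 0) (filtercomap Im at_top)"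

text \<open>
  The n-th Hecke operator in weight k, in the classical normalization; the representatives used
  are the upper triangular matrices with diagonal n/d, d and upper right entry b.
\<close>

definition hecke_operator :: "nat \<Rightarrow> nat \<Rightarrow> (complex \<Rightarrow> complex) \<Rightarrow> complex \<Rightarrow> complex" where
  "hecke_operator k n f z =
     of_nat n powi (int k - 1) *
       (\<Sum>d | d dvd n. of_nat d powi (- int k) *
          (\<Sum>b<d. f ((of_nat (n div d) * z + of_nat b) / of_nat d)))"

definition hecke_eigencuspform :: "nat \<Rightarrow> (complex \<Rightarrow> complex) \<Rightarrow> bool" where
  "hecke_eigencuspform k f \<longleftrightarrow>
     cusp_form k f \<and>
     (\<exists>z\<in>upper_half_plane. f z \<noteq> 0) \<and>
     (\<forall>n\<ge>1. \<exists>c. \<forall>z\<in>upper_half_plane. hecke_operator k n f z = c * f z)"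

text \<open>
  The sequence l is the sequence of normalized Hecke eigenvalues of the eigencuspform f of
  weight k: the multiple s f of f with first Fourier coefficient 1 has n-th Fourier coefficient
  l(n) n^((k-1)/2). The Fourier expansion determines l(n) for all n at least 1; the value l(0)
  has no meaning and is left unconstrained.
\<close>

definition hecke_eigenvalues :: "nat \<Rightarrow> (complex \<Rightarrow> complex) \<Rightarrow> (nat \<Rightarrow> complex) \<Rightarrow> bool" where
  "hecke_eigenvalues k f l \<longleftrightarrow>
     l 1 = 1 \<and>
     (\<exists>s. s \<noteq> 0 \<and> (\<forall>z\<in>upper_half_plane.
        ((\<lambda>n. l n * of_real (real n powr ((real k - 1) / 2)) *
               exp (2 * of_real pi * \<i> * of_nat n * z)) has_sum (s * f z)) {1..}))"

definition smooth :: "(real \<Rightarrow> complex) \<Rightarrow> bool" where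
  "smooth W \<longleftrightarrow>
     (\<exists>D :: nat \<Rightarrow> real \<Rightarrow> complex. D 0 = W \<and>
        (\<forall>m x. (D m has_vector_derivative D (Suc m) x) (at x)))"

definition dyadic :: "real \<Rightarrow> int set" where
  "dyadic X = {n. X \<le> of_int n \<and> of_int n \<le> 2 * X}"

lemma finite_dyadic: "finite (dyadic X)"
proof -
  have "dyadic X \<subseteq> {\<lceil>X\<rceil>..\<lfloor>2 * X\<rfloor>}"
    by (auto simp: dyadic_def ceiling_le_iff le_floor_iff)
  then show ?thesis
    by (rule finite_subset) simp
qed

definition l2norm :: "real \<Rightarrow> (int \<Rightarrow> complex) \<Rightarrow> real" where
  "l2norm X a = sqrt (\<Sum>n\<in>dyadic X. (cmod (a n))\<^sup>2)"

end

theory Submission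
  imports Defs
begin

text \<open>
  The constraint on n, n + h, n - h is linear: with m1 = n + h and m2 = n - h it reads
  m1 + m2 = 2n, and the weight depends on m1 - n only. Expanding both in additive characters
  modulo Q, where Q is of size X, separates the three variables, at the cost of the l1-norm of
  the discrete Fourier transform of the weight, which is logarithmic because the weight has
  bounded variation. The sums of l1(m1) and l2(m2) against additive characters are
  O(X^(1/2) log X) by Wilton's estimate, uniformly in the character, and the sum of a(n) is
  treated in mean square by Parseval. This gives the bound X (log X)^3 times the l2-norm of a,
  which suffices since X is at most (X/H) (XH)^(1/2).

  Wilton's estimate comes from the growth of the cusp form F of weight k near the real axis,
  F(x + iy) = O(y^(-k/2)): one integrates F over a horocycle of height 1/N against a kernel
  that extracts its first N Fourier coefficients and whose L1-norm is logarithmic.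
\<close>

section \<open>Additive characters\<close>

definition unit_char :: "real \<Rightarrow> complex" where
  "unit_char x = cis (2 * pi * x)"

lemma norm_unit_char [simp]: "cmod (unit_char x) = 1"
  by (simp add: unit_char_def)

lemma unit_char_0 [simp]: "unit_char 0 = 1"
  by (simp add: unit_char_def)

lemma unit_char_add: "unit_char (x + y) = unit_char x * unit_char y"
  by (simp add: unit_char_def cis_mult algebra_simps)

lemma unit_char_of_int [simp]: "unit_char (of_int n) = 1"
  by (simp add: unit_char_def)

lemma unit_char_power: "unit_char x ^ n = unit_char (of_nat n * x)"
  by (simp add: unit_char_def Complex.DeMoivre mult_ac)

lemma cnj_unit_char: "cnj (unit_char x) = unit_char (- x)"
  by (simp add: unit_char_def cis_cnj)

lemma unit_char_eq_1_iff: "unit_char x = 1 \<longleftrightarrow> x \<in> \<int>"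
proof
  assume "unit_char x = 1"
  then have "cos (2 * pi * x) = 1"
    by (simp add: unit_char_def complex_eq_iff)
  then obtain n :: int where "2 * pi * x = of_int n * 2 * pi"
    using cos_one_2pi_int[of "2 * pi * x"] by auto
  then have "x = of_int n" by simp
  then show "x \<in> \<int>" by simp
qed (auto elim!: Ints_cases)

text \<open>By concavity the graph of the sine on [0, pi] lies above its chord from 0 to
  pi/2.\<close>

lemma sin_pi_ge:
  fixes x :: real
  assumes "0 \<le> x" "x \<le> 1/2"
  shows "2 * x \<le> sin (pi * x)"
proof -
  have "concave_on {0..pi} sin"
    by (rule f''_le0_imp_concave[where f' = cos and f'' = "\<lambda>x. - sin x"])
       (auto intro!: derivative_eq_intros simp: sin_ge_zero)
  then have "(1 - 2 * x) * sin 0 + 2 * x * sin (pi/2) \<le> sin ((1 - 2 * x) *\<^sub>R 0 + (2 * x) *\<^sub>R (pi/2))"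
    using assms by (intro concave_onD) auto
  then show ?thesis by (simp add: mult.commute)
qed

lemma sin_pi_ge_min:
  fixes x :: real
  assumes "0 \<le> x" "x \<le> 1"
  shows "2 * min x (1 - x) \<le> sin (pi * x)"
proof (cases "x \<le> 1/2")
  case True
  then show ?thesis using sin_pi_ge[of x] assms by (auto simp: min_def)
next
  case False
  have "sin (pi * (1 - x)) = sin (pi * x)"
    by (simp add: right_diff_distrib)
  then show ?thesis using sin_pi_ge[of "1 - x"] assms False by (auto simp: min_def)
qed

text \<open>Denominators of this shape are bounded below twice: with \<open>r > 1\<close> for the
  truncation kernel and with \<open>r = 1\<close> for the discrete Fourier transform. The two terms
  measure how far r is from 1 and x from the integers.\<close>

lemma norm_one_minus_unit_char_scaled:
  fixes r x :: real
  shows "(cmod (1 - of_real r * unit_char x))\<^sup>2 = (1 - r)\<^sup>2 + 4 * r * (sin (pi * x))\<^sup>2"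
proof -
  have c: "cos (2 * pi * x) = 1 - 2 * (sin (pi * x))\<^sup>2"
    using cos_double_sin[of "pi * x"] by (simp add: mult_ac)
  have "(cmod (1 - of_real r * unit_char x))\<^sup>2
      = (1 - r * cos (2 * pi * x))\<^sup>2 + (r * sin (2 * pi * x))\<^sup>2"
    by (simp add: cmod_power2 unit_char_def)
  also have "\<dots> = 1 - 2 * r * cos (2 * pi * x)
      + r\<^sup>2 * ((sin (2 * pi * x))\<^sup>2 + (cos (2 * pi * x))\<^sup>2)"
    by algebra
  also have "\<dots> = (1 - r)\<^sup>2 + 4 * r * (sin (pi * x))\<^sup>2"
    unfolding sin_cos_squared_add unfolding c by (simp add: power2_eq_square algebra_simps)
  finally show ?thesis .
qed

lemma norm_one_minus_unit_char_ge:
  fixes x :: real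
  assumes "0 \<le> x" "x \<le> 1"
  shows "4 * min x (1 - x) \<le> cmod (1 - unit_char x)"
proof -
  have s: "2 * min x (1 - x) \<le> sin (pi * x)" "0 \<le> min x (1 - x)"
    using sin_pi_ge_min assms by auto
  have s0: "0 \<le> sin (pi * x)"
    by (rule order_trans[OF _ s(1)]) (use s(2) in simp)
  have "(cmod (1 - unit_char x))\<^sup>2 = (2 * sin (pi * x))\<^sup>2"
    using norm_one_minus_unit_char_scaled[of 1 x] by (simp add: power_mult_distrib)
  then have "cmod (1 - unit_char x) = 2 * sin (pi * x)"
    by (rule power2_eq_imp_eq) (use s0 in auto)
  then show ?thesis using s by simp
qed

section \<open>Orthogonality and Parseval modulo Q\<close>

lemma sum_unit_char_orthogonality:
  fixes m :: int and Q :: nat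
  assumes "Q > 0"
  shows "(\<Sum>k<Q. unit_char (of_nat k * of_int m / of_nat Q)) = (if int Q dvd m then of_nat Q else 0)"
proof -
  let ?z = "unit_char (of_int m / of_nat Q)"
  have pow: "unit_char (of_nat k * of_int m / of_nat Q) = ?z ^ k" for k
    by (simp add: unit_char_power)
  have z1: "?z = 1 \<longleftrightarrow> int Q dvd m"
  proof -
    have "of_int m / of_nat Q \<in> (\<int> :: real set) \<longleftrightarrow> int Q dvd m"
    proof
      assume "of_int m / of_nat Q \<in> (\<int> :: real set)"
      then obtain j :: int where "of_int m / of_nat Q = (of_int j :: real)"
        by (elim Ints_cases)
      then have "of_int m = (of_int (j * int Q) :: real)"
        using assms by (simp add: field_simps)
      then have "m = j * int Q" by linarith
      then show "int Q dvd m" by simp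
    next
      assume "int Q dvd m"
      then obtain j where "m = int Q * j" by auto
      then show "of_int m / of_nat Q \<in> (\<int> :: real set)" using assms by simp
    qed
    then show ?thesis by (simp add: unit_char_eq_1_iff)
  qed
  have "?z ^ Q = unit_char (of_int m)"
    using assms by (simp add: unit_char_power)
  then have "?z ^ Q = 1" by simp
  then show ?thesis
    unfolding pow using z1 by (simp add: sum_gp_strict)
qed

text \<open>When the square is expanded, the sum over k keeps the pairs with \<open>\<phi> m\<close>
  congruent to \<open>\<phi> n\<close> modulo Q, and \<open>inj\<close> makes these diagonal. The
  map \<open>\<phi>\<close> is there for the frequencies \<open>- 2 * n\<close> of the later
  application.\<close>

lemma parseval_finite:
  fixes a :: "int \<Rightarrow> complex" and Q :: nat
  assumes "finite S" "Q > 0"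
    and inj: "\<And>m n. m \<in> S \<Longrightarrow> n \<in> S \<Longrightarrow> int Q dvd \<phi> m - \<phi> n \<Longrightarrow> m = n"
  shows "(\<Sum>k<Q. (cmod (\<Sum>n\<in>S. a n * unit_char (of_nat k * of_int (\<phi> n) / of_nat Q)))\<^sup>2)
           = of_nat Q * (\<Sum>n\<in>S. (cmod (a n))\<^sup>2)"
proof -
  let ?e = "\<lambda>k m. unit_char (of_nat k * of_int m / of_nat Q)"
  have e: "?e k m * cnj (?e k n) = ?e k (m - n)" for k m n
    unfolding cnj_unit_char unit_char_add[symmetric]
    by (rule arg_cong[where f = unit_char]) (simp add: diff_divide_distrib right_diff_distrib)
  have sq: "complex_of_real ((cmod (\<Sum>n\<in>S. a n * ?e k (\<phi> n)))\<^sup>2)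
      = (\<Sum>m\<in>S. \<Sum>n\<in>S. a m * cnj (a n) * ?e k (\<phi> m - \<phi> n))" for k
    unfolding complex_norm_square cnj_sum sum_product e[symmetric] complex_cnj_mult
    by (intro sum.cong refl) (simp only: mult_ac)
  have "complex_of_real (\<Sum>k<Q. (cmod (\<Sum>n\<in>S. a n * ?e k (\<phi> n)))\<^sup>2)
      = (\<Sum>k<Q. \<Sum>m\<in>S. \<Sum>n\<in>S. a m * cnj (a n) * ?e k (\<phi> m - \<phi> n))"
    unfolding of_real_sum sq ..
  also have "\<dots> = (\<Sum>m\<in>S. \<Sum>k<Q. \<Sum>n\<in>S. a m * cnj (a n) * ?e k (\<phi> m - \<phi> n))"
    by (rule sum.swap)
  also have "\<dots> = (\<Sum>m\<in>S. \<Sum>n\<in>S. \<Sum>k<Q. a m * cnj (a n) * ?e k (\<phi> m - \<phi> n))"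
    by (rule sum.cong[OF refl]) (rule sum.swap)
  also have "\<dots> = (\<Sum>m\<in>S. \<Sum>n\<in>S. a m * cnj (a n) * (\<Sum>k<Q. ?e k (\<phi> m - \<phi> n)))"
    by (simp only: sum_distrib_left)
  also have "\<dots> = (\<Sum>m\<in>S. \<Sum>n\<in>S. if n = m then of_nat Q * (a m * cnj (a m)) else 0)"
    unfolding sum_unit_char_orthogonality[OF \<open>Q > 0\<close>]
    by (intro sum.cong refl) (auto dest: inj)
  also have "\<dots> = (\<Sum>m\<in>S. of_nat Q * (a m * cnj (a m)))"
    using \<open>finite S\<close> by simp
  also have "\<dots> = complex_of_real (of_nat Q * (\<Sum>n\<in>S. (cmod (a n))\<^sup>2))"
    unfolding of_real_mult of_real_sum complex_norm_square by (simp add: sum_distrib_left)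
  finally show ?thesis using of_real_eq_iff by blast
qed

section \<open>Growth of cusp forms near the real axis\<close>

text \<open>This is the k-th power of \<open>v / k \<le> exp (v / k)\<close>. It lets the
  exponential decay of a cusp form at the cusp absorb a power of Im z.\<close>

lemma power_le_exp:
  fixes v :: real and k :: nat
  assumes "v \<ge> 0"
  shows "v ^ k \<le> real k ^ k * exp v"
proof (cases "k = 0")
  case False
  have "v / real k \<le> exp (v / real k)"
    using exp_ge_add_one_self[of "v / real k"] by linarith
  then have "(v / real k) ^ k \<le> exp (v / real k) ^ k"
    using assms by (intro power_mono) auto
  also have "\<dots> = exp v"
    using False by (simp flip: exp_of_nat_mult)
  finally show ?thesis
    using False by (simp add: field_simps)
qed (use assms in simp)

text \<open>
  Dirichlet's theorem replaces the fundamental domain: it yields a rational h/c so close to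
  Re z that a modular substitution with bottom row (c, -h) maps z to a point of height at
  least 1/5.
\<close>

lemma exists_high_translate:
  assumes "0 < Im z" "Im z \<le> 1"
  shows "\<exists>a b c d :: int. a * d - b * c = 1 \<and> of_int c * z + of_int d \<noteq> 0 \<and>
           (cmod (of_int c * z + of_int d))\<^sup>2 \<le> 5 * Im z"
proof -
  define x y where "x = Re z" and "y = Im z"
  define r where "r = sqrt y"
  have y: "0 < y" "y \<le> 1" using assms by (auto simp: y_def)
  have r: "0 < r" "r \<le> 1" "r\<^sup>2 = y" using y by (auto simp: r_def)
  \<comment> \<open>This choice balances the two parts of |c z - h|^2: Dirichlet gives |c x - h| <
    1/N \<le> r, while c y \<le> N y \<le> 2 r. As r^2 = y, the constant is 1 + 4 = 5.\<close>
  define N where "N = nat \<lceil>1 / r\<rceil>"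
  have N1: "1 / r \<le> real N" using r by (simp add: N_def)
  have N2: "real N \<le> 2 / r"
  proof -
    have "real N \<le> 1 / r + 1" using r by (simp add: N_def)
    also have "\<dots> \<le> 2 / r" using r by (simp add: field_simps)
    finally show ?thesis .
  qed
  have N0: "N > 0" using r by (simp add: N_def)
  obtain h c where hc: "coprime h c" "0 < c" "c \<le> int N" "\<bar>of_int c * x - of_int h\<bar> < 1 / N"
    using Dirichlet_approx_coprime[OF N0, of x] by blast
  \<comment> \<open>Coprimality of h and c lets the bottom row (c, -h) be completed to a matrix of
    determinant 1.\<close>
  obtain u v where uv: "u * h + v * c = 1"
    using bezout_int[of h c] hc(1) by (metis coprime_imp_gcd_eq_1)
  have "1 / real N \<le> r"
    using N1 r N0 by (simp add: field_simps)
  then have "\<bar>of_int c * x - of_int h\<bar> \<le> r" using hc(4) by linarith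
  then have s1: "(of_int c * x - of_int h)\<^sup>2 \<le> y"
    using r by (metis abs_le_square_iff abs_of_pos)
  have "real_of_int c \<le> real N" using hc(3) by linarith
  then have "real_of_int c * y \<le> 2 / r * r\<^sup>2"
    using N2 r y hc(2) by (intro mult_mono) auto
  then have "real_of_int c * y \<le> 2 * r"
    using r by (simp add: power2_eq_square)
  then have "(real_of_int c * y)\<^sup>2 \<le> (2 * r)\<^sup>2"
    using hc(2) y by (intro power_mono) auto
  then have s2: "(real_of_int c * y)\<^sup>2 \<le> 4 * y"
    using r by (simp add: power_mult_distrib)
  have "(cmod (of_int c * z + of_int (- h)))\<^sup>2 = (of_int c * x - of_int h)\<^sup>2 + (real_of_int c * y)\<^sup>2"
    by (simp add: cmod_power2 x_def y_def)
  then have "(cmod (of_int c * z + of_int (- h)))\<^sup>2 \<le> 5 * y" using s1 s2 by linarith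
  moreover have "of_int c * z + of_int (- h) \<noteq> 0"
    using hc(2) y by (auto simp: complex_eq_iff y_def)
  moreover have "(- u) * (- h) - (- v) * c = 1" using uv by simp
  ultimately show ?thesis unfolding y_def by blast
qed

lemma Im_modular_substitution:
  fixes a b c d :: int
  assumes "a * d - b * c = 1"
  shows "Im ((of_int a * z + of_int b) / (of_int c * z + of_int d))
           = Im z / (cmod (of_int c * z + of_int d))\<^sup>2"
proof -
  have "of_int a * of_int d - of_int b * of_int c = (1::real)"
    using assms by (metis of_int_1 of_int_diff of_int_mult)
  then have "(of_int a * of_int d - of_int b * of_int c) * Im z = Im z"
    by simp
  then have "of_int a * Im z * (of_int c * Re z + of_int d)
      - (of_int a * Re z + of_int b) * (of_int c * Im z) = Im z"
    by (simp add: algebra_simps)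
  then show ?thesis by (simp add: Im_divide cmod_power2)
qed

text \<open>Summation from n = 1 encodes vanishing at the cusp. The intended F is the multiple of
  the eigenform with first coefficient 1, and \<open>A n\<close> is its coefficient before
  normalization, \<open>l n\<close> times n^((k-1)/2).\<close>

locale modular_fourier_series =
  fixes k :: nat and F :: "complex \<Rightarrow> complex" and A :: "nat \<Rightarrow> complex"
  assumes modular: "\<And>a b c d z. a * d - b * c = (1::int) \<Longrightarrow> Im z > 0 \<Longrightarrow>
      F ((of_int a * z + of_int b) / (of_int c * z + of_int d)) = (of_int c * z + of_int d) ^ k * F z"
    and expansion: "\<And>z. Im z > 0 \<Longrightarrow>
      ((\<lambda>n. A n * exp (2 * of_real pi * \<i> * of_nat n * z)) has_sum F z) {1..}"
begin

lemma norm_expansion_term: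
  "cmod (A n * exp (2 * of_real pi * \<i> * of_nat n * z)) = cmod (A n) * exp (- (2 * pi * real n * Im z))"
  by (simp add: norm_mult)

text \<open>A \<open>has_sum\<close> of complex numbers converges absolutely; this is applied at the
  point i v, where the terms have the norms in question.\<close>

lemma abs_summable_expansion:
  assumes "v > 0"
  shows "(\<lambda>n. cmod (A n) * exp (- (2 * pi * real n * v))) summable_on {1..}"
proof -
  have "(\<lambda>n. A n * exp (2 * of_real pi * \<i> * of_nat n * Complex 0 v)) summable_on {1..}"
    using expansion[of "Complex 0 v"] assms by (auto simp: summable_on_def)
  then have "(\<lambda>n. norm (A n * exp (2 * of_real pi * \<i> * of_nat n * Complex 0 v))) summable_on {1..}"
    by (simp only: summable_on_iff_abs_summable_on_complex)
  then show ?thesis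
    unfolding norm_expansion_term by simp
qed

text \<open>As n \<ge> 1, passing from height 1/5 to height v multiplies the norm of each term by at
  most exp (-2 pi (v - 1/5)), and the square of this factor outweighs v^k. The threshold 1/5 is the
  height that \<open>exists_high_translate\<close> guarantees.\<close>

lemma bounded_away_from_real_axis:
  "\<exists>B. \<forall>z. Im z \<ge> 1/5 \<longrightarrow> (cmod (F z))\<^sup>2 * Im z ^ k \<le> B"
proof -
  define c where "c = (\<lambda>n. cmod (A n) * exp (- (2 * pi * real n * (1/5))))"
  define M where "M = infsum c {1..}"
  have c: "c summable_on {1..}"
    unfolding c_def by (rule abs_summable_expansion) simp
  have "(cmod (F z))\<^sup>2 * Im z ^ k \<le> M\<^sup>2 * (real k ^ k * exp (4 * pi / 5))" if z: "Im z \<ge> 1/5" for z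
  proof -
    define v where "v = Im z"
    let ?t = "\<lambda>n. A n * exp (2 * of_real pi * \<i> * of_nat n * z)"
    let ?q = "exp (- (2 * pi * (v - 1/5)))"
    have v: "v > 0" "v \<ge> 1/5" using z by (auto simp: v_def)
    have sm: "(\<lambda>n. norm (?t n)) summable_on {1..}"
      unfolding norm_expansion_term using abs_summable_expansion[OF v(1)] by (simp add: v_def)
    have bound: "norm (?t n) \<le> c n * ?q" if "n \<in> {1..}" for n
    proof -
      have "1 * (v - 1/5) \<le> real n * (v - 1/5)"
        using that v by (intro mult_right_mono) auto
      then have "2 * pi * (v - 1/5) \<le> 2 * pi * (real n * (v - 1/5))"
        by simp
      then have "- (2 * pi * real n * v) \<le> - (2 * pi * real n * (1/5)) + - (2 * pi * (v - 1/5))"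
        by (simp add: algebra_simps)
      then have "exp (- (2 * pi * real n * v)) \<le> exp (- (2 * pi * real n * (1/5))) * ?q"
        by (simp only: exp_add[symmetric] exp_le_cancel_iff)
      then show ?thesis
        unfolding norm_expansion_term c_def v_def[symmetric]
        by (metis mult.assoc mult_left_mono norm_ge_zero)
    qed
    have "cmod (F z) = norm (infsum ?t {1..})"
      using expansion[of z] v by (simp add: infsumI v_def)
    also have "\<dots> \<le> infsum (\<lambda>n. norm (?t n)) {1..}"
      using sm by (rule norm_infsum_bound)
    also have "\<dots> \<le> infsum (\<lambda>n. c n * ?q) {1..}"
      by (rule infsum_mono[OF sm summable_on_cmult_left[OF c] bound])
    also have "\<dots> = M * ?q"
      unfolding M_def using c by (intro infsum_cmult_left) auto
    finally have "(cmod (F z))\<^sup>2 \<le> (M * ?q)\<^sup>2"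
      by (intro power_mono) auto
    moreover have "v ^ k \<le> real k ^ k * exp v"
      using v by (intro power_le_exp) auto
    ultimately have "(cmod (F z))\<^sup>2 * v ^ k \<le> (M * ?q)\<^sup>2 * (real k ^ k * exp v)"
      using v by (intro mult_mono) auto
    also have "\<dots> = M\<^sup>2 * (real k ^ k * (?q\<^sup>2 * exp v))"
      by (simp add: power_mult_distrib mult_ac)
    \<comment> \<open>The exponent is (1 - 4 pi) v + 4 pi / 5, and 1 - 4 pi is negative.\<close>
    also have "?q\<^sup>2 * exp v \<le> exp (4 * pi / 5)"
    proof -
      have "1 * v \<le> 4 * pi * v"
        using v pi_gt3 by (intro mult_right_mono) auto
      then have "2 * - (2 * pi * (v - 1/5)) + v \<le> 4 * pi / 5"
        by (simp add: algebra_simps)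
      moreover have "?q\<^sup>2 * exp v = exp (2 * - (2 * pi * (v - 1/5)) + v)"
        by (simp only: exp_add exp_double)
      ultimately show ?thesis by simp
    qed
    finally show ?thesis
      by (simp add: v_def mult_left_mono)
  qed
  then show ?thesis by blast
qed

text \<open>The quantity |F(z)|^2 (Im z)^k is invariant under the modular group: F contributes |c z
  + d|^(2k) and the imaginary part the inverse of it. So z can be moved to height at least 1/5,
  where the bound is known.\<close>

lemma growth_near_real_axis:
  "\<exists>B. \<forall>z. 0 < Im z \<and> Im z \<le> 1 \<longrightarrow> (cmod (F z))\<^sup>2 * Im z ^ k \<le> B"
proof -
  obtain B where B: "\<And>z. Im z \<ge> 1/5 \<Longrightarrow> (cmod (F z))\<^sup>2 * Im z ^ k \<le> B"
    using bounded_away_from_real_axis by blast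
  have "(cmod (F z))\<^sup>2 * Im z ^ k \<le> B" if z: "0 < Im z" "Im z \<le> 1" for z
  proof -
    obtain a b c d :: int where m: "a * d - b * c = 1" "of_int c * z + of_int d \<noteq> 0"
      "(cmod (of_int c * z + of_int d))\<^sup>2 \<le> 5 * Im z"
      using exists_high_translate[OF z] by blast
    define q where "q = of_int c * z + of_int d"
    define w where "w = (of_int a * z + of_int b) / q"
    have q: "cmod q > 0" "(cmod q)\<^sup>2 \<le> 5 * Im z" using m by (auto simp: q_def)
    have w: "Im w = Im z / (cmod q)\<^sup>2"
      unfolding w_def q_def by (rule Im_modular_substitution[OF m(1)])
    have Fw: "F w = q ^ k * F z"
      unfolding w_def q_def by (rule modular[OF m(1) z(1)])
    have "1/5 \<le> Im w" using q by (simp add: w field_simps)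
    then have "(cmod (F w))\<^sup>2 * Im w ^ k \<le> B" by (rule B)
    also have "(cmod (F w))\<^sup>2 * Im w ^ k = (cmod (F z))\<^sup>2 * Im z ^ k"
      using q(1) by (simp add: Fw w norm_mult norm_power power_divide power_mult_distrib
          flip: power_mult) (simp add: mult.commute)
    finally show ?thesis .
  qed
  then show ?thesis by blast
qed

end

section \<open>Wilton's estimate\<close>

lemma has_integral_unit_char:
  fixes j :: int
  shows "((\<lambda>x. unit_char (of_int j * x)) has_integral (if j = 0 then 1 else 0)) {0..1}"
proof (cases "j = 0")
  case True
  then show ?thesis using has_integral_const_real[of "1::complex" 0 1] by simp
next
  case False
  let ?G = "\<lambda>x. unit_char (of_int j * x) / (2 * pi * \<i> * of_int j)"
  have "((\<lambda>x. unit_char (of_int j * x)) has_integral (?G 1 - ?G 0)) {0..1}"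
  proof (rule fundamental_theorem_of_calculus)
    fix x :: real
    have "((\<lambda>x. exp (\<i> * (2 * pi * of_int j) * of_real x) / (2 * pi * \<i> * of_int j))
        has_vector_derivative exp (\<i> * (2 * pi * of_int j) * of_real x)) (at x within {0..1})"
      using False
      by (auto intro!: derivative_eq_intros has_vector_derivative_real_field)
    then show "(?G has_vector_derivative unit_char (of_int j * x)) (at x within {0..1})"
      by (simp add: unit_char_def cis_conv_exp mult_ac)
  qed simp
  moreover have "?G 1 = ?G 0"
    using unit_char_of_int[of j] by simp
  ultimately show ?thesis using False by simp
qed

lemma continuous_on_unit_char [continuous_intros]:
  "continuous_on S f \<Longrightarrow> continuous_on S (\<lambda>x. unit_char (f x))"
  unfolding unit_char_def by (intro continuous_intros)

text \<open>
  The kernel that extracts the first N Fourier coefficients on the horocycle of height 1/N; the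
  weights grow only by the bounded factor exp (2 pi).
\<close>

definition truncation_kernel :: "nat \<Rightarrow> real \<Rightarrow> complex" where
  "truncation_kernel N x = (\<Sum>m=1..N. of_real (exp (2 * pi * real m / real N)) * unit_char (- (real m * x)))"

text \<open>The kernel is a geometric sum with ratio \<open>\<rho>\<close> of modulus r = exp (2 pi
  / N). The numerator is bounded because r^N = exp (2 pi), and |1 - \<rho>| is at least half of 1/N
  plus the distance from x to the integers. The two fractions majorize the reciprocal of that sum
  and integrate in closed form.\<close>

lemma norm_truncation_kernel:
  fixes x :: real
  assumes "N \<ge> 1" "0 \<le> x" "x \<le> 1"
  shows "cmod (truncation_kernel N x)
           \<le> 2 * exp (2 * pi) * (1 + exp (2 * pi)) * (1 / (x + 1 / N) + 1 / (1 - x + 1 / N))"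
proof -
  define y r where "y = 1 / real N" and "r = exp (2 * pi * y)"
  define \<rho> where "\<rho> = of_real r * unit_char (- x)"
  define t where "t = min x (1 - x)"
  have y: "0 < y" "y \<le> 1" using assms by (auto simp: y_def)
  have t: "0 \<le> t" using assms by (auto simp: t_def)
  have r1: "1 + 2 * pi * y \<le> r" unfolding r_def by (rule exp_ge_add_one_self)
  have "1 * y \<le> 2 * pi * y" using pi_gt3 y by (intro mult_right_mono) auto
  then have ry: "y \<le> r - 1" and r_ge: "1 \<le> r" using r1 y by linarith+
  have "2 * t \<le> sin (pi * x)" unfolding t_def using assms by (intro sin_pi_ge_min) auto
  then have "(2 * t)\<^sup>2 \<le> (sin (pi * x))\<^sup>2" using t by (intro power_mono) auto
  then have "(2 * t)\<^sup>2 \<le> (sin (pi * (- x)))\<^sup>2" by simp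
  then have "4 * 1 * (2 * t)\<^sup>2 \<le> 4 * r * (sin (pi * (- x)))\<^sup>2"
    using r_ge by (intro mult_mono) auto
  moreover have "y\<^sup>2 \<le> (1 - r)\<^sup>2"
    using ry y by (subst power2_commute) (intro power_mono, auto)
  moreover have "(cmod (1 - \<rho>))\<^sup>2 = (1 - r)\<^sup>2 + 4 * r * (sin (pi * (- x)))\<^sup>2"
    unfolding \<rho>_def by (rule norm_one_minus_unit_char_scaled)
  \<comment> \<open>The quadratic mean dominates the arithmetic mean; this turns the sum of squares
    in |1 - \<rho>|^2 into a lower bound linear in y + t.\<close>
  moreover have "((y + t) / 2)\<^sup>2 \<le> y\<^sup>2 + 4 * 1 * (2 * t)\<^sup>2"
  proof -
    have "(y\<^sup>2 + t\<^sup>2) / 2 - ((y + t) / 2)\<^sup>2 = ((y - t) / 2)\<^sup>2"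
      by (simp add: power2_eq_square field_simps)
    also have "\<dots> \<ge> 0" by simp
    finally have "((y + t) / 2)\<^sup>2 \<le> (y\<^sup>2 + t\<^sup>2) / 2" by simp
    also have "\<dots> \<le> y\<^sup>2 + 4 * 1 * (2 * t)\<^sup>2" by (simp add: power_mult_distrib)
    finally show ?thesis .
  qed
  ultimately have "((y + t) / 2)\<^sup>2 \<le> (cmod (1 - \<rho>))\<^sup>2" by linarith
  then have den: "(y + t) / 2 \<le> cmod (1 - \<rho>)" by (rule power2_le_imp_le) simp
  have pos: "0 < (y + t) / 2" using y t by simp
  then have ne: "\<rho> \<noteq> 1" using den by auto
  have norm_\<rho>: "cmod \<rho> = r" using r_ge by (simp add: \<rho>_def norm_mult)
  have rN: "r ^ N = exp (2 * pi)"
    using assms(1) by (simp add: r_def y_def flip: exp_of_nat_mult)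
  have r_le: "r \<le> exp (2 * pi)"
    using y by (simp add: r_def)
  have "truncation_kernel N x = (\<Sum>m=1..N. \<rho> ^ m)"
    unfolding truncation_kernel_def
  proof (rule sum.cong[OF refl])
    fix m
    have "exp (2 * pi * real m / real N) = r ^ m"
      unfolding r_def y_def by (simp add: mult_ac flip: exp_of_nat_mult)
    moreover have "unit_char (- (real m * x)) = unit_char (- x) ^ m"
      by (simp add: unit_char_power)
    ultimately show "of_real (exp (2 * pi * real m / real N)) * unit_char (- (real m * x)) = \<rho> ^ m"
      by (simp add: \<rho>_def power_mult_distrib)
  qed
  also have "\<dots> = \<rho> * (\<Sum>m<N. \<rho> ^ m)"
    unfolding sum_distrib_left
    by (rule sum.reindex_bij_witness[of _ Suc "\<lambda>m. m - 1"]) (auto simp flip: power_Suc)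
  also have "\<dots> = \<rho> * (1 - \<rho> ^ N) / (1 - \<rho>)"
    using ne by (simp add: sum_gp_strict)
  finally have "cmod (truncation_kernel N x) = r * cmod (1 - \<rho> ^ N) / cmod (1 - \<rho>)"
    by (simp add: norm_mult norm_divide norm_\<rho>)
  also have "\<dots> \<le> exp (2 * pi) * (1 + exp (2 * pi)) / ((y + t) / 2)"
  proof (rule frac_le)
    have "cmod (1 - \<rho> ^ N) \<le> 1 + exp (2 * pi)"
      using norm_triangle_ineq4[of 1 "\<rho> ^ N"] by (simp add: norm_power norm_\<rho> rN)
    then show "r * cmod (1 - \<rho> ^ N) \<le> exp (2 * pi) * (1 + exp (2 * pi))"
      using r_le r_ge by (intro mult_mono) auto
  qed (use den pos in auto)
  also have "\<dots> = 2 * exp (2 * pi) * (1 + exp (2 * pi)) * (1 / (y + t))"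
    by simp
  also have "\<dots> \<le> 2 * exp (2 * pi) * (1 + exp (2 * pi)) * (1 / (x + y) + 1 / (1 - x + y))"
  proof (rule mult_left_mono)
    show "1 / (y + t) \<le> 1 / (x + y) + 1 / (1 - x + y)"
      using assms y by (auto simp: t_def min_def add.commute)
  qed auto
  finally show ?thesis by (simp add: y_def)
qed

text \<open>This integral is the source of the single logarithm in Wilton's estimate; the
  antiderivative is a difference of two logarithms.\<close>

lemma has_integral_kernel_majorant:
  assumes "N \<ge> 1"
  shows "((\<lambda>x. 1 / (x + 1 / real N) + 1 / (1 - x + 1 / real N)) has_integral 2 * ln (real N + 1)) {0..1}"
proof -
  let ?y = "1 / real N"
  let ?G = "\<lambda>x. ln (x + ?y) - ln (1 - x + ?y)"
  have y: "0 < ?y" using assms by simp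
  have "((\<lambda>x. 1 / (x + ?y) + 1 / (1 - x + ?y)) has_integral (?G 1 - ?G 0)) {0..1}"
  proof (rule fundamental_theorem_of_calculus)
    fix x :: real
    assume "x \<in> {0..1}"
    then have "x + ?y > 0" "1 - x + ?y > 0" using y by (auto simp only: atLeastAtMost_iff intro: add_nonneg_pos)
    then show "(?G has_vector_derivative 1 / (x + ?y) + 1 / (1 - x + ?y)) (at x within {0..1})"
      unfolding has_real_derivative_iff_has_vector_derivative[symmetric]
      by (auto intro!: derivative_eq_intros simp: divide_inverse)
  qed simp
  also have "?G 1 - ?G 0 = 2 * (ln (1 + ?y) - ln ?y)" by simp
  also have "ln (1 + ?y) - ln ?y = ln ((1 + ?y) / ?y)"
    using y by (intro ln_divide_pos[symmetric] add_pos_pos) auto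
  also have "(1 + ?y) / ?y = real N + 1"
    using assms by (simp add: field_simps)
  finally show ?thesis .
qed

section \<open>Fourier coefficients from the horocycle of height 1/N\<close>

context modular_fourier_series
begin

text \<open>On the horocycle the n-th coefficient is damped by exp (-2 pi n / N). The weights of the
  kernel undo this for n \<le> N, and orthogonality removes the cross terms and all n > N.\<close>

lemma integral_truncation:
  fixes \<alpha> :: real
  assumes "N \<ge> 1"
  shows "((\<lambda>x. F (Complex (\<alpha> + x) (1 / real N)) * truncation_kernel N x)
           has_integral (\<Sum>n=1..N. A n * unit_char (n * \<alpha>))) {0..1}"
proof -
  define y where "y = 1 / real N"
  have y: "y > 0" using assms by (simp add: y_def)
  \<comment> \<open>\<open>q n\<close> is the n-th Fourier coefficient in x of F along the
    horocycle, and \<open>g n\<close> is what it contributes to the integrand.\<close>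
  define q where "q = (\<lambda>n. A n * of_real (exp (- (2 * pi * real n * y))) * unit_char (real n * \<alpha>))"
  define g where "g = (\<lambda>n x. q n * unit_char (real n * x) * truncation_kernel N x)"
  define KB where "KB = (\<Sum>m=1..N. exp (2 * pi * real m / real N))"
  have KB0: "0 \<le> KB" unfolding KB_def by (intro sum_nonneg) auto
  have KB: "cmod (truncation_kernel N x) \<le> KB" for x
    unfolding truncation_kernel_def KB_def by (rule sum_norm_le) (simp add: norm_mult)
  have fterm: "A n * exp (2 * of_real pi * \<i> * of_nat n * Complex (\<alpha> + x) y)
      = q n * unit_char (real n * x)" for n x
  proof -
    have "2 * of_real pi * \<i> * of_nat n * Complex (\<alpha> + x) y
        = of_real (- (2 * pi * real n * y)) + \<i> * of_real (2 * pi * (real n * \<alpha> + real n * x))"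
      by (simp add: complex_eq_iff algebra_simps)
    then have "exp (2 * of_real pi * \<i> * of_nat n * Complex (\<alpha> + x) y)
        = of_real (exp (- (2 * pi * real n * y))) * unit_char (real n * \<alpha> + real n * x)"
      by (simp only: exp_add exp_of_real unit_char_def cis_conv_exp)
    then show ?thesis by (simp add: q_def unit_char_add)
  qed
  have "(\<lambda>n. cmod (q n)) summable_on {1..}"
    using abs_summable_expansion[OF y] by (simp add: q_def norm_mult)
  \<comment> \<open>Reindexing by \<open>Suc\<close> turns sums over \<open>{1..}\<close> into
    series from 0, the form that the Weierstrass M-test takes.\<close>
  then have "(\<lambda>n. cmod (q (Suc n))) summable_on UNIV"
    by (subst (asm) summable_on_reindex_bij_witness[of "{1..}" Suc "\<lambda>n. n - 1" UNIV "\<lambda>n. cmod (q (Suc n))"]) auto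
  then have summable_q: "summable (\<lambda>n. cmod (q (Suc n)))"
    by (rule summable_on_imp_summable)
  have sums: "(\<lambda>i. g (Suc i) x) sums (F (Complex (\<alpha> + x) y) * truncation_kernel N x)" for x
  proof -
    have "((\<lambda>n. q n * unit_char (real n * x)) has_sum F (Complex (\<alpha> + x) y)) {1..}"
      using expansion[of "Complex (\<alpha> + x) y"] y unfolding fterm by simp
    then have "((\<lambda>i. q (Suc i) * unit_char (real (Suc i) * x)) has_sum F (Complex (\<alpha> + x) y)) UNIV"
      by (subst (asm) has_sum_reindex_bij_witness[of "{1..}" Suc "\<lambda>n. n - 1" UNIV
            "\<lambda>i. q (Suc i) * unit_char (real (Suc i) * x)"]) auto
    then have "(\<lambda>i. q (Suc i) * unit_char (real (Suc i) * x)) sums F (Complex (\<alpha> + x) y)"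
      by (rule has_sum_imp_sums)
    then show ?thesis unfolding g_def by (rule sums_mult2)
  qed
  \<comment> \<open>Uniform convergence is what justifies integrating term by term.\<close>
  have "uniform_limit {0..1} (\<lambda>j x. \<Sum>i<j. g (Suc i) x) (\<lambda>x. \<Sum>i. g (Suc i) x) sequentially"
  proof (rule Weierstrass_m_test)
    show "norm (g (Suc i) x) \<le> cmod (q (Suc i)) * KB" for i x
      unfolding g_def by (simp add: norm_mult KB mult_left_mono)
    show "summable (\<lambda>i. cmod (q (Suc i)) * KB)"
      by (intro summable_mult2 summable_q)
  qed
  then have ul: "uniform_limit {0..1} (\<lambda>j x. \<Sum>i<j. g (Suc i) x)
      (\<lambda>x. F (Complex (\<alpha> + x) y) * truncation_kernel N x) sequentially"
    using sums by (simp add: sums_iff)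
  have g_int: "(g n has_integral (if n \<in> {1..N} then A n * unit_char (n * \<alpha>) else 0)) {0..1}" for n
  proof -
    have "g n = (\<lambda>x. \<Sum>m=1..N. q n * of_real (exp (2 * pi * real m / real N)) * unit_char (of_int (int n - int m) * x))"
    proof
      fix x
      have "unit_char (of_int (int n - int m) * x) = unit_char (real n * x) * unit_char (- (real m * x))" for m
        unfolding unit_char_add[symmetric] by (simp add: left_diff_distrib)
      then show "g n x = (\<Sum>m=1..N. q n * of_real (exp (2 * pi * real m / real N)) * unit_char (of_int (int n - int m) * x))"
        unfolding g_def truncation_kernel_def sum_distrib_left
        by (intro sum.cong refl) (simp add: mult_ac)
    qed
    moreover have "((\<lambda>x. \<Sum>m=1..N. q n * of_real (exp (2 * pi * real m / real N)) * unit_char (of_int (int n - int m) * x))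
        has_integral (\<Sum>m=1..N. q n * of_real (exp (2 * pi * real m / real N)) * (if int n - int m = 0 then 1 else 0))) {0..1}"
      by (intro has_integral_sum has_integral_mult_right has_integral_unit_char) auto
    moreover have "(\<Sum>m=1..N. q n * of_real (exp (2 * pi * real m / real N)) * (if int n - int m = 0 then 1 else 0))
        = (\<Sum>m\<in>{1..N}. if m = n then A n * unit_char (n * \<alpha>) else 0)"
    proof (rule sum.cong[OF refl])
      fix m
      have "exp (- (2 * pi * real n * y)) * exp (2 * pi * real n / real N) = 1"
        by (simp add: y_def flip: exp_add)
      then have "complex_of_real (exp (- (2 * pi * real n * y))) * of_real (exp (2 * pi * real n / real N)) = 1"
        by (metis of_real_1 of_real_mult)
      then have "q n * of_real (exp (2 * pi * real n / real N)) = A n * unit_char (n * \<alpha>)"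
        by (simp add: q_def mult_ac)
      then show "q n * of_real (exp (2 * pi * real m / real N)) * (if int n - int m = 0 then 1 else 0)
          = (if m = n then A n * unit_char (n * \<alpha>) else 0)" by auto
    qed
    ultimately show ?thesis by simp
  qed
  have cont: "continuous_on {0..1} (\<lambda>x. \<Sum>i<j. g (Suc i) x)" for j
    unfolding g_def truncation_kernel_def by (intro continuous_intros)
  obtain I J where IJ: "\<And>j. ((\<lambda>x. \<Sum>i<j. g (Suc i) x) has_integral I j) {0..1}"
    "((\<lambda>x. F (Complex (\<alpha> + x) y) * truncation_kernel N x) has_integral J) {0..1}" "I \<longlonglongrightarrow> J"
    using uniform_limit_integral[OF ul cont] by auto
  \<comment> \<open>From j = N on the partial integrals are constant, since all later terms
    integrate to 0; so this value is their limit J.\<close>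
  have I: "I j = (\<Sum>n=1..N. A n * unit_char (n * \<alpha>))" if "j \<ge> N" for j
  proof -
    have "((\<lambda>x. \<Sum>i<j. g (Suc i) x) has_integral
        (\<Sum>i<j. if Suc i \<in> {1..N} then A (Suc i) * unit_char (Suc i * \<alpha>) else 0)) {0..1}"
      by (intro has_integral_sum g_int) auto
    then have "I j = (\<Sum>i<j. if Suc i \<in> {1..N} then A (Suc i) * unit_char (Suc i * \<alpha>) else 0)"
      using IJ(1) has_integral_unique by blast
    also have "\<dots> = (\<Sum>i<N. A (Suc i) * unit_char (Suc i * \<alpha>))"
      using that by (intro sum.mono_neutral_cong_right) auto
    also have "\<dots> = (\<Sum>n=1..N. A n * unit_char (n * \<alpha>))"
      by (rule sum.reindex_bij_witness[of _ "\<lambda>m. m - 1" Suc]) auto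
    finally show ?thesis .
  qed
  have "J = (\<Sum>n=1..N. A n * unit_char (n * \<alpha>))"
    using LIMSEQ_unique[OF IJ(3) tendsto_eventually] I
    by (auto simp: eventually_at_top_linorder)
  then show ?thesis using IJ(2) unfolding y_def by simp
qed

text \<open>At height 1/N the form is O(N^(k/2)) and the kernel has logarithmic L1-norm. The growth
  bound does not see the real part, whence the uniformity in \<open>\<alpha>\<close>.\<close>

lemma exponential_sum_bound_unnormalized:
  "\<exists>C. \<forall>N\<ge>1. \<forall>\<alpha>::real. cmod (\<Sum>n=1..N. A n * unit_char (n * \<alpha>))
         \<le> C * (real N powr (real k / 2) * (1 + ln (real N)))"
proof -
  obtain B where B: "\<And>z. 0 < Im z \<Longrightarrow> Im z \<le> 1 \<Longrightarrow> (cmod (F z))\<^sup>2 * Im z ^ k \<le> B"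
    using growth_near_real_axis by blast
  define c where "c = 2 * exp (2 * pi) * (1 + exp (2 * pi))"
  have c: "c \<ge> 0" by (simp add: c_def)
  have B0: "0 \<le> B" using B[of \<i>] by (simp add: order_trans[rotated])
  have "cmod (\<Sum>n=1..N. A n * unit_char (n * \<alpha>))
      \<le> (sqrt B * c * 2) * (real N powr (real k / 2) * (1 + ln (real N)))"
    if N: "N \<ge> 1" for N and \<alpha> :: real
  proof -
    let ?y = "1 / real N"
    have F: "cmod (F (Complex (\<alpha> + x) ?y)) \<le> sqrt B * real N powr (real k / 2)" for x
    proof -
      have "(cmod (F (Complex (\<alpha> + x) ?y)))\<^sup>2 * ?y ^ k \<le> B"
        using B[of "Complex (\<alpha> + x) ?y"] N by simp
      then have "(cmod (F (Complex (\<alpha> + x) ?y)))\<^sup>2 \<le> B * real N ^ k"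
        using N by (simp add: field_simps power_divide)
      then have "cmod (F (Complex (\<alpha> + x) ?y)) \<le> sqrt (B * real N ^ k)"
        by (rule real_le_rsqrt)
      also have "\<dots> = sqrt B * real N powr (real k / 2)"
        using N by (simp add: real_sqrt_mult powr_half_sqrt[symmetric] powr_powr flip: powr_realpow)
      finally show ?thesis .
    qed
    have int: "((\<lambda>x. F (Complex (\<alpha> + x) ?y) * truncation_kernel N x)
           has_integral (\<Sum>n=1..N. A n * unit_char (n * \<alpha>))) {0..1}"
      by (rule integral_truncation[OF N])
    have maj: "((\<lambda>x. (sqrt B * real N powr (real k / 2) * c) * (1 / (x + ?y) + 1 / (1 - x + ?y)))
        has_integral (sqrt B * real N powr (real k / 2) * c) * (2 * ln (real N + 1))) {0..1}"
      by (intro has_integral_mult_right has_integral_kernel_majorant[OF N])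
    have le: "norm (F (Complex (\<alpha> + x) ?y) * truncation_kernel N x)
        \<le> (sqrt B * real N powr (real k / 2) * c) * (1 / (x + ?y) + 1 / (1 - x + ?y))"
      if "x \<in> {0..1}" for x
      using mult_mono[OF F norm_truncation_kernel[OF N, of x]] that B0
      by (simp add: norm_mult c_def mult_ac)
    have "cmod (\<Sum>n=1..N. A n * unit_char (n * \<alpha>))
        \<le> (sqrt B * real N powr (real k / 2) * c) * (2 * ln (real N + 1))"
      using integral_norm_bound_integral[OF has_integral_integrable[OF int] has_integral_integrable[OF maj] le]
      by (simp only: integral_unique[OF int] integral_unique[OF maj])
    also have "\<dots> \<le> (sqrt B * real N powr (real k / 2) * c) * (2 * (1 + ln (real N)))"
    proof (intro mult_left_mono)
      have "2 * real N \<le> exp 1 * real N"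
        using exp_ge_add_one_self[of 1] by (intro mult_right_mono) auto
      then have "real N + 1 \<le> exp 1 * real N" using N by linarith
      then have "ln (real N + 1) \<le> ln (exp 1 * real N)"
        using N by (subst ln_le_cancel_iff) auto
      also have "\<dots> = 1 + ln (real N)" using N by (simp add: ln_mult)
      finally show "ln (real N + 1) \<le> 1 + ln (real N)" .
    qed (use c B0 in auto)
    finally show ?thesis by (simp only: mult_ac)
  qed
  then show ?thesis by blast
qed

end


section \<open>Passage to normalized eigenvalues by partial summation\<close>

lemma summation_by_parts:
  fixes w u :: "nat \<Rightarrow> 'a :: comm_ring"
  shows "(\<Sum>n=1..N. w n * u n)
    = w (Suc N) * (\<Sum>n=1..N. u n) + (\<Sum>n=1..N. (w n - w (Suc n)) * (\<Sum>m=1..n. u m))"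
  by (induction N) (simp_all add: algebra_simps)

lemma sum_powr_minus_half_le: "(\<Sum>n=1..N. real n powr (- (1/2))) \<le> 2 * sqrt (real N)"
proof (induction N)
  case (Suc N)
  define a b where "a = sqrt (real N)" and "b = sqrt (real (Suc N))"
  have ab: "0 \<le> a" "0 < b" "a\<^sup>2 = real N" "b\<^sup>2 = real N + 1" by (auto simp: a_def b_def)
  \<comment> \<open>Since b^2 - a^2 = 1, this rearranges to 1/b \<le> 2 (b - a), the increment
    needed for the induction.\<close>
  have "0 \<le> (b - a)\<^sup>2" by simp
  then have "2 * a * b + 1 \<le> 2 * b * b"
    using ab by (simp add: power2_eq_square algebra_simps)
  then have "2 * a + 1 / b \<le> 2 * b"
    using ab by (simp add: field_simps)
  moreover have "real (Suc N) powr (- (1/2)) = 1 / b"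
    by (simp add: b_def powr_minus_divide powr_half_sqrt)
  ultimately show ?case using Suc.IH by (simp add: a_def b_def)
qed simp

lemma powr_minus_diff_le:
  fixes s :: real
  assumes "n \<ge> 1" "s \<ge> -1"
  shows "\<bar>real n powr (- s) - real (Suc n) powr (- s)\<bar> \<le> \<bar>s\<bar> * real n powr (- s - 1)"
proof -
  have "\<exists>z>real n. z < real (Suc n) \<and> real (Suc n) powr (- s) - real n powr (- s)
      = (real (Suc n) - real n) * (- s * z powr (- s - 1))"
    using assms(1) by (intro MVT2) (auto intro!: derivative_eq_intros simp: powr_diff)
  then obtain z where z: "z > real n" "real (Suc n) powr (- s) - real n powr (- s) = - s * z powr (- s - 1)"
    by auto
  have "\<bar>real n powr (- s) - real (Suc n) powr (- s)\<bar> = \<bar>s\<bar> * z powr (- s - 1)"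
    using z(2) by (subst abs_minus_commute) (simp add: abs_mult)
  also have "\<dots> \<le> \<bar>s\<bar> * real n powr (- s - 1)"
    using z assms by (intro mult_left_mono powr_mono2') auto
  finally show ?thesis .
qed

text \<open>Dividing by n^s with s = (k - 1) / 2 turns N^(k/2) into N^(1/2) in the boundary term of
  the partial summation and leaves the sum of n^(-1/2) in the rest, so no further logarithm is
  lost.\<close>

lemma exponential_sum_bound:
  assumes "hecke_eigencuspform k f" "hecke_eigenvalues k f l"
  shows "\<exists>C. \<forall>N\<ge>1. \<forall>\<alpha>::real. cmod (\<Sum>n=1..N. l n * unit_char (n * \<alpha>))
           \<le> C * (sqrt (real N) * (1 + ln (real N)))"
proof -
  define s where "s = (real k - 1) / 2"
  obtain \<sigma> where \<sigma>: "\<And>z. Im z > 0 \<Longrightarrow> ((\<lambda>n. l n * of_real (real n powr s) *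
               exp (2 * of_real pi * \<i> * of_nat n * z)) has_sum (\<sigma> * f z)) {1..}"
    using assms(2) unfolding hecke_eigenvalues_def upper_half_plane_def s_def by auto
  define A where "A = (\<lambda>n. l n * of_real (real n powr s))"
  have "modular_fourier_series k (\<lambda>z. \<sigma> * f z) A"
  proof
    fix a b c d :: int and z :: complex
    assume "a * d - b * c = 1" "Im z > 0"
    then have "f ((of_int a * z + of_int b) / (of_int c * z + of_int d)) = (of_int c * z + of_int d) ^ k * f z"
      using assms(1) unfolding hecke_eigencuspform_def cusp_form_def upper_half_plane_def by blast
    then show "\<sigma> * f ((of_int a * z + of_int b) / (of_int c * z + of_int d))
        = (of_int c * z + of_int d) ^ k * (\<sigma> * f z)"
      by (simp only: mult.left_commute)
  next
    fix z :: complex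
    assume "Im z > 0"
    then show "((\<lambda>n. A n * exp (2 * of_real pi * \<i> * of_nat n * z)) has_sum (\<sigma> * f z)) {1..}"
      unfolding A_def by (rule \<sigma>)
  qed
  then interpret modular_fourier_series k "\<lambda>z. \<sigma> * f z" A .
  from exponential_sum_bound_unnormalized
  obtain C where "\<forall>N\<ge>1. \<forall>\<alpha>::real. cmod (\<Sum>n=1..N. A n * unit_char (n * \<alpha>))
      \<le> C * (real N powr (real k / 2) * (1 + ln (real N)))" ..
  then have C: "cmod (\<Sum>n=1..N. A n * unit_char (n * \<alpha>)) \<le> C * (real N powr (real k / 2) * (1 + ln (real N)))"
    if "N \<ge> 1" for N and \<alpha> :: real
    using that by simp
  have C0: "C \<ge> 0" using order_trans[OF norm_ge_zero C[of 1 0]] by simp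
  have "cmod (\<Sum>n=1..N. l n * unit_char (n * \<alpha>)) \<le> (C * (2 + 2 * \<bar>s\<bar>)) * (sqrt (real N) * (1 + ln (real N)))"
    if N: "N \<ge> 1" for N and \<alpha> :: real
  proof -
    define L where "L = 1 + ln (real N)"
    define w where "w = (\<lambda>n. complex_of_real (real n powr (- s)))"
    define u where "u = (\<lambda>n. A n * unit_char (n * \<alpha>))"
    define T where "T = (\<lambda>n. \<Sum>m=1..n. u m)"
    have L: "L \<ge> 1" using N by (simp add: L_def)
    have T: "cmod (T n) \<le> C * L * real n powr (real k / 2)" if "n \<in> {1..N}" for n
    proof -
      have "cmod (T n) \<le> C * (real n powr (real k / 2) * (1 + ln (real n)))"
        unfolding T_def u_def using that by (intro C) auto
      also have "\<dots> \<le> C * (real n powr (real k / 2) * L)"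
        using that C0 by (intro mult_left_mono) (auto simp: L_def)
      finally show ?thesis by (simp add: mult_ac)
    qed
    have "(\<Sum>n=1..N. l n * unit_char (n * \<alpha>)) = (\<Sum>n=1..N. w n * u n)"
    proof (rule sum.cong[OF refl])
      fix n assume "n \<in> {1..N}"
      then have "real n powr (- s) * real n powr s = 1"
        by (simp flip: powr_add)
      then have "w n * of_real (real n powr s) = 1"
        unfolding w_def by (metis of_real_1 of_real_mult)
      then show "l n * unit_char (n * \<alpha>) = w n * u n"
        by (simp add: u_def A_def algebra_simps)
    qed
    also have "\<dots> = w (Suc N) * T N + (\<Sum>n=1..N. (w n - w (Suc n)) * T n)"
      unfolding T_def by (rule summation_by_parts)
    finally have "cmod (\<Sum>n=1..N. l n * unit_char (n * \<alpha>))
        \<le> cmod (w (Suc N)) * cmod (T N) + (\<Sum>n=1..N. cmod (w n - w (Suc n)) * cmod (T n))"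
      using norm_triangle_ineq[of "w (Suc N) * T N" "\<Sum>n=1..N. (w n - w (Suc n)) * T n"]
        norm_sum[of "\<lambda>n. (w n - w (Suc n)) * T n" "{1..N}"]
      by (simp add: norm_mult)
    also have "cmod (w (Suc N)) * cmod (T N) \<le> C * L * (2 * sqrt (real N))"
    proof -
      have "cmod (w (Suc N)) * cmod (T N) \<le> real (Suc N) powr (- s) * (C * L * real N powr (real k / 2))"
        using T[of N] N by (intro mult_mono) (auto simp: w_def)
      \<comment> \<open>Raising the base to N + 1 lets the exponents -s and k/2 combine to
        1/2.\<close>
      also have "\<dots> \<le> real (Suc N) powr (- s) * (C * L * real (Suc N) powr (real k / 2))"
        using C0 L by (intro mult_left_mono powr_mono2) auto
      also have "\<dots> = C * L * real (Suc N) powr (1/2)"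
        by (simp add: s_def mult_ac flip: powr_add) (simp add: field_simps)
      also have "\<dots> \<le> C * L * (2 * sqrt (real N))"
      proof (rule mult_left_mono)
        have "sqrt (real (Suc N)) \<le> sqrt (2\<^sup>2 * real N)" using N by (intro real_sqrt_le_mono) auto
        then show "real (Suc N) powr (1/2) \<le> 2 * sqrt (real N)"
          unfolding real_sqrt_mult by (simp add: powr_half_sqrt)
      qed (use C0 L in auto)
      finally show ?thesis .
    qed
    also have "(\<Sum>n=1..N. cmod (w n - w (Suc n)) * cmod (T n))
        \<le> (\<Sum>n=1..N. C * L * \<bar>s\<bar> * real n powr (- (1/2)))"
    proof (rule sum_mono)
      fix n assume n: "n \<in> {1..N}"
      have "cmod (w n - w (Suc n)) = \<bar>real n powr (- s) - real (Suc n) powr (- s)\<bar>"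
        unfolding w_def of_real_diff[symmetric] norm_of_real ..
      also have "\<dots> \<le> \<bar>s\<bar> * real n powr (- s - 1)"
        using n by (intro powr_minus_diff_le) (auto simp: s_def field_simps)
      finally have "cmod (w n - w (Suc n)) * cmod (T n)
          \<le> (\<bar>s\<bar> * real n powr (- s - 1)) * (C * L * real n powr (real k / 2))"
        using T[OF n] by (intro mult_mono) auto
      also have "\<dots> = C * L * \<bar>s\<bar> * (real n powr (- s - 1) * real n powr (real k / 2))"
        by (simp add: mult_ac)
      also have "real n powr (- s - 1) * real n powr (real k / 2) = real n powr (- (1/2))"
        unfolding powr_add[symmetric] by (simp add: s_def field_simps)
      finally show "cmod (w n - w (Suc n)) * cmod (T n) \<le> C * L * \<bar>s\<bar> * real n powr (- (1/2))" .
    qed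
    also have "\<dots> \<le> C * L * \<bar>s\<bar> * (2 * sqrt (real N))"
      unfolding sum_distrib_left[symmetric] using C0 L
      by (intro mult_left_mono sum_powr_minus_half_le) auto
    finally show ?thesis by (simp add: L_def algebra_simps)
  qed
  then show ?thesis by blast
qed

section \<open>Separation of variables\<close>

text \<open>The factor 1/Q is placed here and not in the inversion formula, so that the l1-norm over
  k is exactly the cost of separating the variables.\<close>

definition dft :: "nat \<Rightarrow> (int \<Rightarrow> complex) \<Rightarrow> nat \<Rightarrow> complex" where
  "dft Q w k = (\<Sum>j<Q. w (int j) * unit_char (- (real k * real j / real Q))) / of_nat Q"

text \<open>Summing over k first singles out the one j in [0, Q) congruent to h; hence the reduction
  of h modulo Q in the result.\<close>

lemma dft_inversion:
  assumes "Q > 0"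
  shows "(\<Sum>k<Q. dft Q w k * unit_char (real k * of_int h / real Q)) = w (h mod int Q)"
proof -
  have "(\<Sum>k<Q. dft Q w k * unit_char (real k * of_int h / real Q))
      = (\<Sum>k<Q. \<Sum>j<Q. w (int j) / of_nat Q * unit_char (real k * of_int (h - int j) / real Q))"
  proof (rule sum.cong[OF refl])
    fix k
    have "unit_char (- (real k * real j / real Q)) * unit_char (real k * of_int h / real Q)
        = unit_char (real k * of_int (h - int j) / real Q)" for j
      unfolding unit_char_add[symmetric]
      by (rule arg_cong[where f = unit_char]) (simp add: diff_divide_distrib right_diff_distrib)
    then show "dft Q w k * unit_char (real k * of_int h / real Q)
        = (\<Sum>j<Q. w (int j) / of_nat Q * unit_char (real k * of_int (h - int j) / real Q))"
      unfolding dft_def sum_divide_distrib sum_distrib_right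
      by (intro sum.cong refl) (simp del: of_int_diff)
  qed
  also have "\<dots> = (\<Sum>j<Q. w (int j) / of_nat Q * (\<Sum>k<Q. unit_char (real k * of_int (h - int j) / real Q)))"
    unfolding sum_distrib_left by (rule sum.swap)
  also have "\<dots> = (\<Sum>j<Q. if j = nat (h mod int Q) then w (h mod int Q) else 0)"
  proof (rule sum.cong[OF refl])
    fix j assume "j \<in> {..<Q}"
    then have "int Q dvd h - int j \<longleftrightarrow> h mod int Q = int j"
      by (metis lessThan_iff mod_eq_dvd_iff mod_pos_pos_trivial of_nat_0_le_iff of_nat_less_iff)
    then show "w (int j) / of_nat Q * (\<Sum>k<Q. unit_char (real k * of_int (h - int j) / real Q))
        = (if j = nat (h mod int Q) then w (h mod int Q) else 0)"
      unfolding sum_unit_char_orthogonality[OF assms] using assms by auto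
  qed
  also have "\<dots> = w (h mod int Q)"
    using assms by (simp add: nat_less_iff)
  finally show ?thesis .
qed

lemma sum_inverse_le_ln:
  assumes "N \<ge> 1"
  shows "(\<Sum>n=1..N. 1 / real n) \<le> 1 + ln (real N)"
  using assms
proof (induction N rule: dec_induct)
  case (step N)
  have "ln (real N / real (Suc N)) \<le> real N / real (Suc N) - 1"
    using step.hyps by (intro ln_le_minus_one) auto
  also have "\<dots> = - 1 / real (Suc N)" by (simp add: field_simps)
  finally have "1 / real (Suc N) \<le> ln (real (Suc N)) - ln (real N)"
    using step.hyps by (simp add: ln_divide_pos)
  then show ?case using step.IH by simp
qed simp

text \<open>Summation by parts over a full period: as \<open>w (int Q) = w 0\<close> there is no
  boundary term, and multiplying the transform by z - 1 replaces w by its differences. The lower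
  bound 4 min (k, Q - k) / Q for |z - 1| then cancels the normalization 1/Q.\<close>

lemma norm_dft_le:
  assumes "w (int Q) = w 0" "0 < k" "k < Q"
    and V: "(\<Sum>j<Q. cmod (w (int j + 1) - w (int j))) \<le> V"
  shows "cmod (dft Q w k) \<le> V / 4 * (1 / real k + 1 / real (Q - k))"
proof -
  let ?e = "\<lambda>j. unit_char (- (real k * real j / real Q))"
  define z where "z = unit_char (real k / real Q)"
  have Q: "Q > 0" using assms by simp
  have shift: "?e j = z * ?e (Suc j)" for j
    unfolding z_def unit_char_add[symmetric]
    by (rule arg_cong[where f = unit_char]) (use Q in \<open>simp add: field_simps\<close>)
  have "?e Q = unit_char (of_int (- int k))" using Q by simp
  then have eQ: "?e Q = 1" by (simp only: unit_char_of_int)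
  have "(\<Sum>j<Q. w (int (Suc j)) * ?e (Suc j) - w (int j) * ?e j) = w (int Q) * ?e Q - w (int 0) * ?e 0"
    by (rule sum_lessThan_telescope)
  then have "(\<Sum>j<Q. w (int (Suc j)) * ?e (Suc j)) = (\<Sum>j<Q. w (int j) * ?e j)"
    using eQ assms(1) by (simp add: sum_subtractf)
  moreover have "w (int (Suc j)) * ?e j = z * (w (int (Suc j)) * ?e (Suc j))" for j
    by (subst shift) (rule mult.left_commute)
  then have "(\<Sum>j<Q. w (int (Suc j)) * ?e j) = z * (\<Sum>j<Q. w (int (Suc j)) * ?e (Suc j))"
    by (simp only: sum_distrib_left)
  ultimately have "(\<Sum>j<Q. w (int (Suc j)) * ?e j) = z * (\<Sum>j<Q. w (int j) * ?e j)"
    by (simp only:)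
  then have "(\<Sum>j<Q. (w (int j + 1) - w (int j)) * ?e j) = (z - 1) * (\<Sum>j<Q. w (int j) * ?e j)"
    by (simp add: left_diff_distrib sum_subtractf add.commute)
  also have "\<dots> = (z - 1) * (of_nat Q * dft Q w k)"
    using Q by (simp add: dft_def)
  finally have "cmod (z - 1) * (real Q * cmod (dft Q w k)) = cmod (\<Sum>j<Q. (w (int j + 1) - w (int j)) * ?e j)"
    by (simp add: norm_mult)
  also have "\<dots> \<le> (\<Sum>j<Q. cmod (w (int j + 1) - w (int j)))"
    by (rule sum_norm_le) (simp add: norm_mult)
  also have "\<dots> \<le> V" by (rule V)
  finally have le: "cmod (z - 1) * (real Q * cmod (dft Q w k)) \<le> V" .
  define t where "t = min (real k) (real (Q - k))"
  have t: "t > 0" using assms by (simp add: t_def)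
  have "4 * min (real k / real Q) (1 - real k / real Q) \<le> cmod (1 - z)"
    unfolding z_def using assms by (intro norm_one_minus_unit_char_ge) auto
  then have "real Q * (4 * min (real k / real Q) (1 - real k / real Q)) \<le> real Q * cmod (1 - z)"
    by (rule mult_left_mono) simp
  moreover have "real Q * min (real k / real Q) (1 - real k / real Q) = t"
    using assms by (simp add: t_def min_mult_distrib_left right_diff_distrib of_nat_diff)
  ultimately have "4 * t \<le> real Q * cmod (1 - z)"
    by (simp only: mult.left_commute[of "real Q" 4])
  then have "4 * t * cmod (dft Q w k) \<le> real Q * cmod (1 - z) * cmod (dft Q w k)"
    by (rule mult_right_mono) simp
  also have "\<dots> \<le> V"
    using le by (simp add: norm_minus_commute mult_ac)
  finally have "cmod (dft Q w k) \<le> V / 4 * (1 / t)"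
    using t by (simp add: field_simps)
  also have "\<dots> \<le> V / 4 * (1 / real k + 1 / real (Q - k))"
  proof (rule mult_left_mono)
    show "1 / t \<le> 1 / real k + 1 / real (Q - k)"
      using assms by (auto simp: t_def min_def)
    have "0 \<le> (\<Sum>j<Q. cmod (w (int j + 1) - w (int j)))" by (intro sum_nonneg) auto
    then show "0 \<le> V / 4" using V by linarith
  qed
  finally show ?thesis .
qed

text \<open>Frequency 0 is bounded trivially by B; the others give harmonic sums from both ends of
  the period, which agree under k \<mapsto> Q - k.\<close>

lemma sum_norm_dft_le:
  assumes "Q > 0" "w (int Q) = w 0"
    and B: "\<And>h. cmod (w h) \<le> B"
    and V: "(\<Sum>j<Q. cmod (w (int j + 1) - w (int j))) \<le> V"
  shows "(\<Sum>k<Q. cmod (dft Q w k)) \<le> (B + V) * (1 + ln (real Q))"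
proof -
  have V0: "0 \<le> V" by (rule order_trans[OF sum_nonneg V]) auto
  have B0: "0 \<le> B" by (rule order_trans[OF norm_ge_zero B])
  have L: "0 \<le> ln (real Q)" using assms(1) by simp
  have "cmod (\<Sum>j<Q. w (int j)) \<le> (\<Sum>j<Q. B)"
    by (rule sum_norm_le) (rule B)
  then have c0: "cmod (dft Q w 0) \<le> B"
    using assms(1) by (simp add: dft_def norm_divide field_simps)
  have harm: "(\<Sum>k=1..Q-1. 1 / real k) \<le> 1 + ln (real Q)"
  proof -
    have "(\<Sum>k=1..Q-1. 1 / real k) \<le> (\<Sum>k=1..Q. 1 / real k)"
      by (rule sum_mono2) auto
    also have "\<dots> \<le> 1 + ln (real Q)" using assms(1) by (intro sum_inverse_le_ln) auto
    finally show ?thesis .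
  qed
  have harm': "(\<Sum>k=1..Q-1. 1 / real (Q - k)) = (\<Sum>k=1..Q-1. 1 / real k)"
    by (rule sum.reindex_bij_witness[of _ "\<lambda>k. Q - k" "\<lambda>k. Q - k"]) auto
  have "{..<Q} = insert 0 {1..Q-1}" using assms(1) by auto
  then have "(\<Sum>k<Q. cmod (dft Q w k)) = cmod (dft Q w 0) + (\<Sum>k=1..Q-1. cmod (dft Q w k))"
    by simp
  also have "\<dots> \<le> B + (\<Sum>k=1..Q-1. V / 4 * (1 / real k + 1 / real (Q - k)))"
    using assms by (intro add_mono c0 sum_mono norm_dft_le) auto
  also have "\<dots> = B + V / 2 * (\<Sum>k=1..Q-1. 1 / real k)"
    unfolding sum_distrib_left[symmetric] sum.distrib harm' by simp
  also have "\<dots> \<le> B * (1 + ln (real Q)) + V * (1 + ln (real Q))"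
  proof (rule add_mono)
    show "B \<le> B * (1 + ln (real Q))" using B0 L by (simp add: mult_left_le_one_le algebra_simps)
    show "V / 2 * (\<Sum>k=1..Q-1. 1 / real k) \<le> V * (1 + ln (real Q))"
      using V0 harm by (intro mult_mono sum_nonneg) auto
  qed
  finally show ?thesis by (simp add: algebra_simps)
qed

text \<open>
  Modulo Q = 2M + 1 the congruence m1 + m2 = 2n forces equality, because both sides lie in
  an interval of length less than Q, and n \<mapsto> 2n stays injective, as Parseval requires.
\<close>

lemma correlation_sum_bound:
  fixes l1 l2 :: "nat \<Rightarrow> complex" and a :: "int \<Rightarrow> complex" and c :: "nat \<Rightarrow> complex"
    and M :: nat
  defines "Q \<equiv> 2 * M + 1"
  assumes S: "finite S" "S \<subseteq> {0..int M}"
    and B1: "\<And>\<alpha>::real. cmod (\<Sum>m=1..M. l1 m * unit_char (m * \<alpha>)) \<le> B1"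
    and B2: "\<And>\<alpha>::real. cmod (\<Sum>m=1..M. l2 m * unit_char (m * \<alpha>)) \<le> B2"
  shows "cmod (\<Sum>n\<in>S. \<Sum>m1=1..M. \<Sum>m2=1..M. if int m1 + int m2 = 2 * n
            then a n * l1 m1 * l2 m2 * (\<Sum>k<Q. c k * unit_char (real k * of_int (int m1 - n) / real Q)) else 0)
         \<le> (\<Sum>k<Q. cmod (c k)) * (B1 * B2) * sqrt (\<Sum>n\<in>S. (cmod (a n))\<^sup>2)"
proof -
  have Q: "Q > 0" "int Q = 2 * int M + 1" by (simp_all add: Q_def)
  have rangeS: "0 \<le> n \<and> n \<le> int M" if "n \<in> S" for n
    using S that by auto
  have B0: "0 \<le> B1" "0 \<le> B2"
    using order_trans[OF norm_ge_zero B1] order_trans[OF norm_ge_zero B2] by auto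
  \<comment> \<open>The index k is the frequency of the weight, whose character splits between m1
    and n; l is the frequency that detects m1 + m2 = 2 n. \<open>A k l\<close> collects what depends
    on n.\<close>
  define A where "A = (\<lambda>k l. \<Sum>n\<in>S. (a n * unit_char (- (real k * of_int n / real Q))) *
      unit_char (real l * of_int (- 2 * n) / real Q))"
  define E1 where "E1 = (\<lambda>\<alpha>::real. \<Sum>m=1..M. l1 m * unit_char (m * \<alpha>))"
  define E2 where "E2 = (\<lambda>\<alpha>::real. \<Sum>m=1..M. l2 m * unit_char (m * \<alpha>))"
  define P where "P = S \<times> ({1..M} \<times> {1..M})"
  define t where "t = (\<lambda>k l (n, m1, m2).
      c k * ((a n * unit_char (- (real k * of_int n / real Q))) * unit_char (real l * of_int (- 2 * n) / real Q))
      * (l1 m1 * unit_char (m1 * (real (k + l) / real Q))) * (l2 m2 * unit_char (m2 * (real l / real Q))))"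
  define g where "g = (\<lambda>(n, m1, m2). if int m1 + int m2 = 2 * n
            then a n * l1 m1 * l2 m2 * (\<Sum>k<Q. c k * unit_char (real k * of_int (int m1 - n) / real Q)) else 0)"
  have prod: "c k * A k l * E1 (real (k + l) / real Q) * E2 (real l / real Q) = (\<Sum>p\<in>P. t k l p)" for k l
  proof -
    have "c k * A k l * E1 (real (k + l) / real Q) * E2 (real l / real Q)
      = (\<Sum>n\<in>S. \<Sum>m1=1..M. \<Sum>m2=1..M. t k l (n, m1, m2))"
      unfolding A_def E1_def E2_def t_def sum_distrib_left sum_distrib_right prod.case
      by (subst (2) sum.swap, subst sum.swap, subst (2) sum.swap) (rule refl)
    then show ?thesis by (simp add: P_def sum.cartesian_product split_def)
  qed
  have g: "(\<Sum>k<Q. \<Sum>l<Q. t k l p) = of_nat Q * g p" if "p \<in> P" for p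
  proof -
    obtain n m1 m2 where p: "p = (n, m1, m2)" by (cases p) auto
    have mem: "n \<in> S" "m1 \<in> {1..M}" "m2 \<in> {1..M}" using that by (auto simp: p P_def)
    have "t k l p = (a n * l1 m1 * l2 m2) * ((c k * unit_char (real k * of_int (int m1 - n) / real Q)) *
        unit_char (real l * of_int (int m1 + int m2 - 2 * n) / real Q))" for k l
    proof -
      have "t k l p = (a n * l1 m1 * l2 m2) * (c k * (unit_char (- (real k * of_int n / real Q))
          * unit_char (real l * of_int (- 2 * n) / real Q)
          * unit_char (m1 * (real (k + l) / real Q)) * unit_char (m2 * (real l / real Q))))"
        by (simp only: t_def p prod.case mult_ac)
      also have "unit_char (- (real k * of_int n / real Q)) * unit_char (real l * of_int (- 2 * n) / real Q)
          * unit_char (m1 * (real (k + l) / real Q)) * unit_char (m2 * (real l / real Q))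
          = unit_char (real k * of_int (int m1 - n) / real Q) *
            unit_char (real l * of_int (int m1 + int m2 - 2 * n) / real Q)"
        unfolding unit_char_add[symmetric]
        by (rule arg_cong[where f = unit_char]) (use Q in \<open>simp add: field_simps\<close>)
      finally show ?thesis by (simp only: mult.assoc)
    qed
    then have "(\<Sum>k<Q. \<Sum>l<Q. t k l p) = (a n * l1 m1 * l2 m2) *
        ((\<Sum>k<Q. c k * unit_char (real k * of_int (int m1 - n) / real Q)) *
         (\<Sum>l<Q. unit_char (real l * of_int (int m1 + int m2 - 2 * n) / real Q)))"
      by (subst sum_product) (simp only: sum_distrib_left)
    moreover have "int Q dvd int m1 + int m2 - 2 * n \<longleftrightarrow> int m1 + int m2 = 2 * n"
    proof
      assume "int Q dvd int m1 + int m2 - 2 * n"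
      moreover have "\<bar>int m1 + int m2 - 2 * n\<bar> < int Q"
        using rangeS[OF mem(1)] mem(2,3) Q(2) by auto
      ultimately have "int m1 + int m2 - 2 * n = 0" using dvd_imp_le_int[of "int m1 + int m2 - 2 * n" "int Q"] by linarith
      then show "int m1 + int m2 = 2 * n" by simp
    qed simp
    ultimately show ?thesis
      unfolding sum_unit_char_orthogonality[OF Q(1)] by (auto simp: g_def p)
  qed
  have sumA: "(\<Sum>l<Q. cmod (A k l)) \<le> real Q * sqrt (\<Sum>n\<in>S. (cmod (a n))\<^sup>2)" for k
  proof -
    have "(\<Sum>l<Q. (cmod (A k l))\<^sup>2) = of_nat Q * (\<Sum>n\<in>S. (cmod (a n * unit_char (- (real k * of_int n / real Q))))\<^sup>2)"
      unfolding A_def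
    proof (rule parseval_finite[OF S(1) Q(1)])
      fix m n assume mn: "m \<in> S" "n \<in> S" "int Q dvd - 2 * m - - 2 * n"
      then have "\<bar>- 2 * m - - 2 * n\<bar> < int Q"
        using rangeS[OF mn(1)] rangeS[OF mn(2)] Q(2) by auto
      then have "- 2 * m - - 2 * n = 0"
        using mn(3) dvd_imp_le_int[of "- 2 * m - - 2 * n" "int Q"] by linarith
      then show "m = n" by simp
    qed
    then have sq: "(\<Sum>l<Q. (cmod (A k l))\<^sup>2) = of_nat Q * (\<Sum>n\<in>S. (cmod (a n))\<^sup>2)"
      by (simp add: norm_mult)
    \<comment> \<open>Cauchy-Schwarz over the Q values of l costs sqrt Q, and Parseval another sqrt
      Q; the total Q is cancelled at the end by the factor Q from orthogonality.\<close>
    have "(\<Sum>l<Q. cmod (A k l) * 1)\<^sup>2 \<le> (\<Sum>l<Q. (cmod (A k l))\<^sup>2) * (\<Sum>l<Q. 1\<^sup>2)"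
      by (rule Cauchy_Schwarz_ineq_sum)
    also have "\<dots> = (real Q)\<^sup>2 * (\<Sum>n\<in>S. (cmod (a n))\<^sup>2)"
      unfolding sq by (simp add: power2_eq_square)
    finally have "(\<Sum>l<Q. cmod (A k l)) \<le> sqrt ((real Q)\<^sup>2 * (\<Sum>n\<in>S. (cmod (a n))\<^sup>2))"
      by (intro real_le_rsqrt) simp
    then show ?thesis by (simp add: real_sqrt_mult)
  qed
  have "of_nat Q * (\<Sum>p\<in>P. g p) = (\<Sum>p\<in>P. \<Sum>k<Q. \<Sum>l<Q. t k l p)"
    unfolding sum_distrib_left by (intro sum.cong refl g[symmetric])
  also have "\<dots> = (\<Sum>k<Q. \<Sum>p\<in>P. \<Sum>l<Q. t k l p)" by (rule sum.swap)
  also have "\<dots> = (\<Sum>k<Q. \<Sum>l<Q. \<Sum>p\<in>P. t k l p)"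
    by (rule sum.cong[OF refl]) (rule sum.swap)
  also have "\<dots> = (\<Sum>k<Q. \<Sum>l<Q. c k * A k l * E1 (real (k + l) / real Q) * E2 (real l / real Q))"
    unfolding prod ..
  finally have "real Q * cmod (\<Sum>p\<in>P. g p)
      = cmod (\<Sum>k<Q. \<Sum>l<Q. c k * A k l * E1 (real (k + l) / real Q) * E2 (real l / real Q))"
    by (metis norm_mult norm_of_nat)
  also have "\<dots> \<le> (\<Sum>k<Q. \<Sum>l<Q. cmod (c k) * cmod (A k l) * (B1 * B2))"
  proof (intro sum_norm_le)
    fix k l
    \<comment> \<open>The frequencies (k + l) / Q and l / Q vary with k and l, so the uniformity of
      \<open>B1\<close> and \<open>B2\<close> in \<open>\<alpha>\<close> enters here.\<close>
    have "cmod (E1 (real (k + l) / real Q)) * cmod (E2 (real l / real Q)) \<le> B1 * B2"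
      unfolding E1_def E2_def using B0 by (intro mult_mono B1 B2) auto
    then show "cmod (c k * A k l * E1 (real (k + l) / real Q) * E2 (real l / real Q))
        \<le> cmod (c k) * cmod (A k l) * (B1 * B2)"
      by (simp add: norm_mult mult.assoc mult_left_mono)
  qed
  also have "\<dots> = (\<Sum>k<Q. cmod (c k) * (B1 * B2) * (\<Sum>l<Q. cmod (A k l)))"
    by (simp add: sum_distrib_left mult_ac)
  also have "\<dots> \<le> (\<Sum>k<Q. cmod (c k) * (B1 * B2) * (real Q * sqrt (\<Sum>n\<in>S. (cmod (a n))\<^sup>2)))"
    using B0 by (intro sum_mono mult_left_mono sumA) auto
  also have "\<dots> = real Q * ((\<Sum>k<Q. cmod (c k)) * (B1 * B2) * sqrt (\<Sum>n\<in>S. (cmod (a n))\<^sup>2))"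
    by (simp only: sum_distrib_left sum_distrib_right mult_ac)
  finally have "cmod (\<Sum>p\<in>P. g p) \<le> (\<Sum>k<Q. cmod (c k)) * (B1 * B2) * sqrt (\<Sum>n\<in>S. (cmod (a n))\<^sup>2)"
    using Q(1) by simp
  moreover have "(\<Sum>p\<in>P. g p) = (\<Sum>n\<in>S. \<Sum>m1=1..M. \<Sum>m2=1..M. g (n, m1, m2))"
    by (simp add: P_def sum.cartesian_product split_def)
  ultimately show ?thesis by (simp add: g_def)
qed

section \<open>The correlation sum\<close>

text \<open>Consecutive values W (j / H) differ by O(1/H), and O(H) values of j reach the support,
  so the variation is bounded uniformly in H. As H \<ge> 1, the interval [0, 3] contains j / H and
  (j + 1) / H for all these j.\<close>

lemma smooth_bounded_variation:
  assumes "smooth W" and supp: "closure {x. W x \<noteq> 0} \<subseteq> {1..2}"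
  shows "\<exists>B V. (\<forall>x. cmod (W x) \<le> B) \<and>
           (\<forall>H\<ge>1. \<forall>Q. (\<Sum>j<Q. cmod (W (of_int (int j + 1) / H) - W (of_int (int j) / H))) \<le> V)"
proof -
  obtain D where D: "D 0 = W" "\<And>m x. (D m has_vector_derivative D (Suc m) x) (at x)"
    using assms(1) unfolding smooth_def by blast
  have cont: "continuous_on S (D m)" for S m
    using D(2) by (meson continuous_at_imp_continuous_on has_vector_derivative_continuous)
  have zero: "W x = 0" if "x \<notin> {1..2}" for x
    using that supp closure_subset[of "{x. W x \<noteq> 0}"] by blast
  have "bounded (D m ` {0..3})" for m
    by (intro compact_imp_bounded compact_continuous_image cont) auto
  then obtain b where b: "\<And>m x. x \<in> {0..3} \<Longrightarrow> cmod (D m x) \<le> b m"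
    unfolding bounded_iff by (metis imageI)
  have b0: "0 \<le> b m" for m using order_trans[OF norm_ge_zero b[of 0 m]] by simp
  have "cmod (W x) \<le> b 0" for x
    using b[of x 0] zero[of x] b0[of 0] D(1) by (cases "x \<in> {1..2}") auto
  moreover have "(\<Sum>j<Q. cmod (W (of_int (int j + 1) / H) - W (of_int (int j) / H))) \<le> 3 * b 1"
    if H: "H \<ge> 1" for H Q
  proof -
    \<comment> \<open>The lower end is H - 1 because a difference can be nonzero as soon as j + 1
      reaches H.\<close>
    define J where "J = {nat \<lceil>H - 1\<rceil>..nat \<lfloor>2 * H\<rfloor>}"
    have inJ: "j \<in> J" if "W (of_int (int j + 1) / H) - W (of_int (int j) / H) \<noteq> 0" for j
    proof -
      have "W (of_int (int j + 1) / H) \<noteq> 0 \<or> W (of_int (int j) / H) \<noteq> 0" using that by auto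
      then have "of_int (int j + 1) / H \<in> {1..2} \<or> of_int (int j) / H \<in> {1..2}" using zero by blast
      then have "H - 1 \<le> real j \<and> real j \<le> 2 * H" using H by (auto simp: field_simps)
      then have "\<lceil>H - 1\<rceil> \<le> int j" "j \<le> nat \<lfloor>2 * H\<rfloor>"
        by (simp_all only: ceiling_le_iff le_nat_floor of_int_of_nat_eq)
      then show ?thesis by (simp add: J_def nat_le_iff)
    qed
    have step: "cmod (W (of_int (int j + 1) / H) - W (of_int (int j) / H)) \<le> b 1 / H" if j: "j \<in> J" for j
    proof -
      have "real j \<le> 2 * H" using j H by (simp add: J_def) linarith
      then have r: "0 \<le> real j / H" "(real j + 1) / H \<le> 3" using H by (auto simp: field_simps)
      have "norm (D 0 ((real j + 1) / H) - D 0 (real j / H)) \<le> b 1 * norm ((real j + 1) / H - real j / H)"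
      proof (rule differentiable_bound[where S = "{0..3}" and f' = "\<lambda>x h. h *\<^sub>R D 1 x"])
        show "(D 0 has_derivative (\<lambda>h. h *\<^sub>R D 1 x)) (at x within {0..3})" for x
          using D(2)[of 0 x] has_vector_derivative_at_within
          unfolding has_vector_derivative_def by (auto intro: has_derivative_at_withinI)
        show "onorm (\<lambda>h. h *\<^sub>R D 1 x) \<le> b 1" if "x \<in> {0..3}" for x
          by (rule onorm_le) (use b[OF that, of 1] in \<open>simp add: mult.commute mult_left_mono\<close>)
        have "real j / H \<le> (real j + 1) / H" using H by (intro divide_right_mono) auto
        then show "real j / H \<in> {0..3}" "(real j + 1) / H \<in> {0..3}" using r by auto
      qed auto
      also have "norm ((real j + 1) / H - real j / H) = 1 / H"
        using H by (simp flip: diff_divide_distrib)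
      finally show ?thesis by (simp add: D(1))
    qed
    have "(\<Sum>j<Q. cmod (W (of_int (int j + 1) / H) - W (of_int (int j) / H)))
        = (\<Sum>j\<in>{..<Q} \<inter> J. cmod (W (of_int (int j + 1) / H) - W (of_int (int j) / H)))"
      using inJ by (intro sum.mono_neutral_right) fastforce+
    also have "\<dots> \<le> (\<Sum>j\<in>{..<Q} \<inter> J. b 1 / H)"
      by (intro sum_mono step) auto
    also have "\<dots> = real (card ({..<Q} \<inter> J)) * (b 1 / H)" by simp
    also have "\<dots> \<le> (3 * H) * (b 1 / H)"
    proof (rule mult_right_mono)
      \<comment> \<open>\<open>J\<close> has at most H + 2 elements, hence at most 3 H.\<close>
      have "card ({..<Q} \<inter> J) \<le> card J" by (intro card_mono) (auto simp: J_def)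
      then have "real (card ({..<Q} \<inter> J)) \<le> real (Suc (nat \<lfloor>2 * H\<rfloor>) - nat \<lceil>H - 1\<rceil>)"
        by (simp add: J_def)
      also have "\<dots> \<le> 3 * H" using H by (auto simp: of_nat_diff) linarith+
      finally show "real (card ({..<Q} \<inter> J)) \<le> 3 * H" .
    qed (use H b0 in auto)
    also have "\<dots> = 3 * b 1" using H by simp
    finally show ?thesis .
  qed
  ultimately show ?thesis by blast
qed

text \<open>Each h corresponds to the pair m1 = n + h, m2 = n - h, and the pairs that arise are
  those with m1 + m2 = 2 n. As H \<le> X / 3, on the support both n + h and n - h lie between 1 and
  3 X, so the truncation in \<open>nat\<close> does no harm.\<close>

lemma correlation_sum_reindex:
  fixes W :: "real \<Rightarrow> complex" and X H :: real
  assumes supp: "\<And>x. x \<notin> {1..2} \<Longrightarrow> W x = 0" and XH: "1 \<le> H" "H \<le> X / 3"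
  defines "M \<equiv> nat \<lfloor>3 * X\<rfloor>"
  shows "(\<Sum>\<^sub>\<infinity>h::int. W (of_int h / H) * (\<Sum>n\<in>dyadic X. a n * l1 (nat (n + h)) * l2 (nat (n - h))))
    = (\<Sum>n\<in>dyadic X. \<Sum>m1=1..M. \<Sum>m2=1..M. if int m1 + int m2 = 2 * n
         then a n * l1 m1 * l2 m2 * W (of_int (int m1 - n) / H) else 0)"
proof -
  define R where "R = {1..int M}"
  have Mi: "m \<le> int M \<longleftrightarrow> of_int m \<le> 3 * X" for m
    using XH by (simp add: M_def le_floor_iff)
  have hrange: "H \<le> of_int h \<and> of_int h \<le> 2 * H" if "W (of_int h / H) \<noteq> 0" for h :: int
  proof -
    have "of_int h / H \<in> {1..2}" using that supp by blast
    then show ?thesis using XH by (simp add: field_simps)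
  qed
  have hR: "h \<in> R" if "W (of_int h / H) \<noteq> 0" for h
  proof -
    have "1 \<le> real_of_int h" "real_of_int h \<le> 3 * X" using hrange[OF that] XH by linarith+
    then show ?thesis by (simp add: R_def Mi)
  qed
  \<comment> \<open>Finitely many h give a nonzero term, so \<open>infsum\<close> is a genuine sum
    here and not its default value 0.\<close>
  have "(\<Sum>\<^sub>\<infinity>h::int. W (of_int h / H) * (\<Sum>n\<in>dyadic X. a n * l1 (nat (n + h)) * l2 (nat (n - h))))
      = (\<Sum>\<^sub>\<infinity>h\<in>R. W (of_int h / H) * (\<Sum>n\<in>dyadic X. a n * l1 (nat (n + h)) * l2 (nat (n - h))))"
    using hR by (intro infsum_cong_neutral) auto
  also have "\<dots> = (\<Sum>h\<in>R. W (of_int h / H) * (\<Sum>n\<in>dyadic X. a n * l1 (nat (n + h)) * l2 (nat (n - h))))"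
    by (rule infsum_finite) (simp add: R_def)
  also have "\<dots> = (\<Sum>n\<in>dyadic X. \<Sum>h\<in>R. a n * l1 (nat (n + h)) * l2 (nat (n - h)) * W (of_int h / H))"
    unfolding sum_distrib_left by (subst sum.swap) (simp only: mult_ac)
  also have "\<dots> = (\<Sum>n\<in>dyadic X. \<Sum>m1=1..M. \<Sum>m2=1..M. if int m1 + int m2 = 2 * n
         then a n * l1 m1 * l2 m2 * W (of_int (int m1 - n) / H) else 0)"
  proof (rule sum.cong[OF refl])
    fix n assume "n \<in> dyadic X"
    then have n: "X \<le> of_int n" "of_int n \<le> 2 * X" by (auto simp: dyadic_def)
    let ?f = "\<lambda>h. a n * l1 (nat (n + h)) * l2 (nat (n - h)) * W (of_int h / H)"
    let ?D = "{p \<in> {1..M} \<times> {1..M}. int (fst p) + int (snd p) = 2 * n}"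
    \<comment> \<open>\<open>R'\<close> consists of the h whose pair falls into the square of side
      M. As W vanishes at every h outside \<open>R\<close> or outside \<open>R'\<close>, the ranges
      can be exchanged through their intersection.\<close>
    define R' where "R' = {h. 1 \<le> n + h \<and> n + h \<le> int M \<and> 1 \<le> n - h \<and> n - h \<le> int M}"
    have finR': "finite R'"
      by (rule finite_subset[of _ "{1 - n..int M - n}"]) (auto simp: R'_def)
    have hR': "h \<in> R'" if "W (of_int h / H) \<noteq> 0" for h
    proof -
      have "1 \<le> real_of_int (n + h)" "real_of_int (n + h) \<le> 3 * X"
        "0 < real_of_int (n - h)" "real_of_int (n - h) \<le> 3 * X"
        using hrange[OF that] XH n by simp_all
      then show ?thesis unfolding R'_def by (simp add: Mi del: of_int_add of_int_diff)
    qed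
    have "(\<Sum>h\<in>R. ?f h) = (\<Sum>h\<in>R \<inter> R'. ?f h)"
      using hR' by (intro sum.mono_neutral_right) (auto simp: R_def)
    also have "\<dots> = (\<Sum>h\<in>R'. ?f h)"
      using hR finR' by (intro sum.mono_neutral_left) auto
    also have "\<dots> = (\<Sum>p\<in>?D. a n * l1 (fst p) * l2 (snd p) * W (of_int (int (fst p) - n) / H))"
      by (rule sum.reindex_bij_witness[of _ "\<lambda>p. int (fst p) - n" "\<lambda>h. (nat (n + h), nat (n - h))"])
         (auto simp: R'_def)
    also have "\<dots> = (\<Sum>p\<in>{1..M} \<times> {1..M}. if int (fst p) + int (snd p) = 2 * n
         then a n * l1 (fst p) * l2 (snd p) * W (of_int (int (fst p) - n) / H) else 0)"
      by (rule sum.inter_filter) simp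
    also have "\<dots> = (\<Sum>m1=1..M. \<Sum>m2=1..M. if int m1 + int m2 = 2 * n
         then a n * l1 m1 * l2 m2 * W (of_int (int m1 - n) / H) else 0)"
      by (simp add: sum.cartesian_product split_def)
    finally show "(\<Sum>h\<in>R. ?f h) = \<dots>" .
  qed
  finally show ?thesis .
qed

text \<open>The constant comes from \<open>ln x \<le> x powr \<delta> / \<delta>\<close>. The factor
  9 is there because the modulus Q will be at most 9 X.\<close>

lemma one_plus_ln_le_powr:
  fixes \<delta> :: real
  assumes "\<delta> > 0"
  shows "\<exists>K>0. \<forall>x\<ge>(1::real). 1 + ln (9 * x) \<le> K * x powr \<delta>"
proof (intro exI[of _ "1 + ln 9 + 1 / \<delta>"] conjI allI impI)
  have ln9: "0 \<le> ln (9 :: real)" by simp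
  then show "0 < 1 + ln 9 + 1 / \<delta>" using assms by (intro add_pos_pos add_pos_nonneg) auto
  fix x :: real assume x: "x \<ge> 1"
  have "1 * (1 + ln 9) \<le> x powr \<delta> * (1 + ln 9)"
    using x assms ln9 by (intro mult_right_mono) (auto intro: ge_one_powr_ge_zero)
  moreover have "ln x \<le> x powr \<delta> / \<delta>" using x assms by (rule ln_powr_bound)
  moreover have "ln (9 * x) = ln 9 + ln x" using x by (simp add: ln_mult)
  ultimately show "1 + ln (9 * x) \<le> (1 + ln 9 + 1 / \<delta>) * x powr \<delta>"
    by (simp add: algebra_simps)
qed

theorem theorem1p3:
  fixes W :: "real \<Rightarrow> complex"
    and k1 k2 :: nat
    and f1 f2 :: "complex \<Rightarrow> complex"
    and l1 l2 :: "nat \<Rightarrow> complex"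
    and \<epsilon> :: real
  assumes "smooth W"
    and "closure {x. W x \<noteq> 0} \<subseteq> {1..2}"
    and "hecke_eigencuspform k1 f1" and "hecke_eigenvalues k1 f1 l1"
    and "hecke_eigencuspform k2 f2" and "hecke_eigenvalues k2 f2 l2"
    and "\<epsilon> > 0"
  shows "\<exists>K>0. \<forall>(X::real) (H::real) (a :: int \<Rightarrow> complex).
           1 \<le> H \<and> H \<le> X / 3 \<longrightarrow>
           cmod (\<Sum>\<^sub>\<infinity>h::int. W (of_int h / H) *
                   (\<Sum>n\<in>dyadic X. a n * l1 (nat (n + h)) * l2 (nat (n - h))))
             \<le> K * (X powr \<epsilon> * (X / H) * (sqrt (X * H) + X / sqrt H) * l2norm X a)"
proof -
  obtain B V where BV: "\<And>x. cmod (W x) \<le> B"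
    "\<And>H Q. H \<ge> 1 \<Longrightarrow> (\<Sum>j<Q. cmod (W (of_int (int j + 1) / H) - W (of_int (int j) / H))) \<le> V"
    using smooth_bounded_variation[OF assms(1,2)] by blast
  have B0: "0 \<le> B" by (rule order_trans[OF norm_ge_zero BV(1)])
  have V0: "0 \<le> V" using BV(2)[of 1 0] by simp
  have supp: "W x = 0" if "x \<notin> {1..2}" for x
    using that assms(2) closure_subset[of "{x. W x \<noteq> 0}"] by blast
  from exponential_sum_bound[OF assms(3,4)] obtain C1 where
    "\<forall>N\<ge>1. \<forall>\<alpha>::real. cmod (\<Sum>n=1..N. l1 n * unit_char (n * \<alpha>)) \<le> C1 * (sqrt (real N) * (1 + ln (real N)))" ..
  then have C1: "cmod (\<Sum>n=1..N. l1 n * unit_char (n * \<alpha>)) \<le> C1 * (sqrt (real N) * (1 + ln (real N)))"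
    if "N \<ge> 1" for N and \<alpha> :: real using that by simp
  from exponential_sum_bound[OF assms(5,6)] obtain C2 where
    "\<forall>N\<ge>1. \<forall>\<alpha>::real. cmod (\<Sum>n=1..N. l2 n * unit_char (n * \<alpha>)) \<le> C2 * (sqrt (real N) * (1 + ln (real N)))" ..
  then have C2: "cmod (\<Sum>n=1..N. l2 n * unit_char (n * \<alpha>)) \<le> C2 * (sqrt (real N) * (1 + ln (real N)))"
    if "N \<ge> 1" for N and \<alpha> :: real using that by simp
  have C0: "0 \<le> C1" "0 \<le> C2"
    using order_trans[OF norm_ge_zero C1[of 1 0]] order_trans[OF norm_ge_zero C2[of 1 0]] by auto
  \<comment> \<open>Three logarithms have to be absorbed, two from Wilton's estimate and one from
    the transform of the weight; hence \<epsilon> / 3 for each.\<close>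
  obtain K where K: "K > 0" "\<And>x. x \<ge> 1 \<Longrightarrow> 1 + ln (9 * x) \<le> K * x powr (\<epsilon> / 3)"
    using one_plus_ln_le_powr[of "\<epsilon> / 3"] assms(7) by auto
  \<comment> \<open>\<open>B + V\<close> comes from the transform of the weight, \<open>C1\<close>
    and \<open>C2\<close> from the exponential sums, 3 from M \<le> 3 X, and \<open>K ^ 3\<close>
    from the three logarithms.\<close>
  define K' where "K' = (B + V) * C1 * C2 * 3 * K ^ 3"
  have K'0: "0 \<le> K'" using B0 V0 C0 K(1) by (simp add: K'_def)
  have "cmod (\<Sum>\<^sub>\<infinity>h::int. W (of_int h / H) *
                   (\<Sum>n\<in>dyadic X. a n * l1 (nat (n + h)) * l2 (nat (n - h))))
             \<le> (K' + 1) * (X powr \<epsilon> * (X / H) * (sqrt (X * H) + X / sqrt H) * l2norm X a)"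
    if XH: "1 \<le> H" "H \<le> X / 3" for X H :: real and a :: "int \<Rightarrow> complex"
  proof -
    define M where "M = nat \<lfloor>3 * X\<rfloor>"
    define Q where "Q = 2 * M + 1"
    define w where "w = (\<lambda>h::int. W (of_int h / H))"
    define L where "L = 1 + ln (9 * X)"
    have X: "X \<ge> 3" using XH by linarith
    have M: "real M \<le> 3 * X" "3 * X < real M + 1" using X by (auto simp: M_def)
    have M1: "M \<ge> 1" using M X by linarith
    have Q: "Q > 0" "real Q \<le> 9 * X" using M X by (auto simp: Q_def)
    \<comment> \<open>An integer above M exceeds 3 X, hence 2 H.\<close>
    have wzero: "w h = 0" if "h \<le> 0 \<or> h > int M" for h
    proof -
      have "of_int h \<le> (0::real) \<or> real M + 1 \<le> of_int h" using that by linarith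
      then have "of_int h < H \<or> 2 * H < of_int h" using M XH by linarith
      then have "of_int h / H \<notin> {1..2}" using XH by (auto simp: field_simps)
      then show ?thesis unfolding w_def by (rule supp)
    qed
    have L0: "0 \<le> L" using X by (simp add: L_def)
    have lnM: "1 + ln (real M) \<le> L" and lnQ: "1 + ln (real Q) \<le> L"
      using M M1 Q X by (auto simp: L_def)
    have dyadic_sub: "dyadic X \<subseteq> {0..int M}"
      using X by (auto simp: dyadic_def M_def le_floor_iff)
    have eq: "(\<Sum>k<Q. dft Q w k * unit_char (real k * of_int (int m1 - n) / real Q)) = W (of_int (int m1 - n) / H)"
      if "m1 \<in> {1..M}" "n \<in> dyadic X" for m1 n
    proof -
      have n: "0 \<le> n" "n \<le> int M" using that(2) dyadic_sub by auto
      \<comment> \<open>Wrapping around modulo Q is harmless: if m1 < n, the residue is m1 - n + Q >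
        M, where w vanishes just as at the negative number m1 - n.\<close>
      have "w ((int m1 - n) mod int Q) = w (int m1 - n)"
      proof (cases "int m1 - n \<ge> 0")
        case True
        then show ?thesis using that n by (simp add: Q_def)
      next
        case False
        then have "(int m1 - n) mod int Q = int m1 - n + int Q"
          using mod_pos_pos_trivial[of "int m1 - n + int Q" "int Q"] that n by (simp add: Q_def)
        then show ?thesis using False that n by (simp add: wzero Q_def)
      qed
      then show ?thesis unfolding dft_inversion[OF Q(1)] by (simp add: w_def)
    qed
    have dft_sum: "(\<Sum>k<Q. cmod (dft Q w k)) \<le> (B + V) * L"
    proof -
      have "(\<Sum>k<Q. cmod (dft Q w k)) \<le> (B + V) * (1 + ln (real Q))"
      proof (rule sum_norm_dft_le[OF Q(1)])
        show "w (int Q) = w 0" by (simp add: wzero Q_def)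
      qed (use BV(1) BV(2)[OF XH(1)] in \<open>auto simp: w_def\<close>)
      also have "\<dots> \<le> (B + V) * L" using lnQ B0 V0 by (intro mult_left_mono) auto
      finally show ?thesis .
    qed
    have E1: "cmod (\<Sum>m=1..M. l1 m * unit_char (m * \<alpha>)) \<le> C1 * (sqrt (real M) * L)" for \<alpha> :: real
      using C1[OF M1, of \<alpha>] mult_left_mono[OF mult_left_mono[OF lnM, of "sqrt (real M)"] C0(1)] by simp
    have E2: "cmod (\<Sum>m=1..M. l2 m * unit_char (m * \<alpha>)) \<le> C2 * (sqrt (real M) * L)" for \<alpha> :: real
      using C2[OF M1, of \<alpha>] mult_left_mono[OF mult_left_mono[OF lnM, of "sqrt (real M)"] C0(2)] by simp
    have "cmod (\<Sum>\<^sub>\<infinity>h::int. W (of_int h / H) *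
                   (\<Sum>n\<in>dyadic X. a n * l1 (nat (n + h)) * l2 (nat (n - h))))
      = cmod (\<Sum>n\<in>dyadic X. \<Sum>m1=1..M. \<Sum>m2=1..M. if int m1 + int m2 = 2 * n
            then a n * l1 m1 * l2 m2 * (\<Sum>k<Q. dft Q w k * unit_char (real k * of_int (int m1 - n) / real Q)) else 0)"
    proof (intro arg_cong[where f = cmod])
      have "(\<Sum>\<^sub>\<infinity>h::int. W (of_int h / H) * (\<Sum>n\<in>dyadic X. a n * l1 (nat (n + h)) * l2 (nat (n - h))))
        = (\<Sum>n\<in>dyadic X. \<Sum>m1=1..M. \<Sum>m2=1..M. if int m1 + int m2 = 2 * n
             then a n * l1 m1 * l2 m2 * W (of_int (int m1 - n) / H) else 0)"
        unfolding M_def by (rule correlation_sum_reindex[OF _ XH]) (rule supp)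
      also have "\<dots> = (\<Sum>n\<in>dyadic X. \<Sum>m1=1..M. \<Sum>m2=1..M. if int m1 + int m2 = 2 * n
            then a n * l1 m1 * l2 m2 * (\<Sum>k<Q. dft Q w k * unit_char (real k * of_int (int m1 - n) / real Q)) else 0)"
        by (intro sum.cong refl) (simp only: eq)
      finally show "(\<Sum>\<^sub>\<infinity>h::int. W (of_int h / H) * (\<Sum>n\<in>dyadic X. a n * l1 (nat (n + h)) * l2 (nat (n - h)))) = \<dots>" .
    qed
    also have "\<dots> \<le> (\<Sum>k<Q. cmod (dft Q w k)) * (C1 * (sqrt (real M) * L) * (C2 * (sqrt (real M) * L)))
        * sqrt (\<Sum>n\<in>dyadic X. (cmod (a n))\<^sup>2)"
      unfolding Q_def by (rule correlation_sum_bound[OF finite_dyadic dyadic_sub E1 E2])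
    also have "\<dots> \<le> ((B + V) * L) * (C1 * (sqrt (real M) * L) * (C2 * (sqrt (real M) * L))) * l2norm X a"
      unfolding l2norm_def using C0 L0 dft_sum
      by (intro mult_right_mono) (auto intro!: sum_nonneg)
    also have "\<dots> = (B + V) * C1 * C2 * (sqrt (real M) * sqrt (real M)) * L ^ 3 * l2norm X a"
      by (simp only: power3_eq_cube mult_ac)
    also have "\<dots> = (B + V) * C1 * C2 * real M * L ^ 3 * l2norm X a" by simp
    also have "\<dots> \<le> (B + V) * C1 * C2 * (3 * X) * (K ^ 3 * X powr \<epsilon>) * l2norm X a"
    proof -
      have "L ^ 3 \<le> (K * X powr (\<epsilon> / 3)) ^ 3"
        using K(2)[of X] X L0 by (intro power_mono) (auto simp: L_def)
      also have "\<dots> = K ^ 3 * X powr \<epsilon>"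
        using X by (simp add: power_mult_distrib powr_powr flip: powr_realpow)
      finally have "L ^ 3 \<le> K ^ 3 * X powr \<epsilon>" .
      then show ?thesis
        using B0 V0 C0 M X L0 by (intro mult_right_mono mult_mono) (auto simp: l2norm_def intro!: sum_nonneg)
    qed
    also have "\<dots> = K' * (X powr \<epsilon> * X * l2norm X a)"
      by (simp add: K'_def)
    also have "\<dots> \<le> (K' + 1) * (X powr \<epsilon> * ((X / H) * (sqrt (X * H) + X / sqrt H)) * l2norm X a)"
    proof (intro mult_mono mult_right_mono mult_left_mono)
      \<comment> \<open>As H \<le> X, the term (X H)^(1/2) alone is at least H, so X is at most X /
        H times the bracket.\<close>
      have "sqrt (H * H) \<le> sqrt (X * H)"
        using XH X by (intro real_sqrt_le_mono mult_right_mono) auto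
      then have "H \<le> sqrt (X * H) + X / sqrt H"
        using XH X by (simp add: add_increasing2)
      then have "(X / H) * H \<le> (X / H) * (sqrt (X * H) + X / sqrt H)"
        using XH X by (intro mult_left_mono) auto
      then show "X \<le> (X / H) * (sqrt (X * H) + X / sqrt H)" using XH by simp
    qed (use X XH K'0 in \<open>auto simp: l2norm_def intro!: sum_nonneg mult_nonneg_nonneg divide_nonneg_nonneg\<close>)
    finally show ?thesis by (simp only: mult.assoc)
  qed
  \<comment> \<open>\<open>K'\<close> is known to be nonnegative; adding 1 makes the constant
    positive.\<close>
  then show ?thesis using K'0 by (intro exI[of _ "K' + 1"]) auto
qed

end
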